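(* Let $n\ge 8$ be an integer, and let $k$ be an integer such that $3\le k\le\lceil n/3\rceil+2$ or $\lfloor 2n/3\rfloor-2\le k\le n-3$. Then the multiplicative inverse function $f_{\mathrm{inv}}$ on $\mathbb F_{2^n}$ is not $k$th order sum-free.
   Context: The multiplicative inverse function $f_{\mathrm{inv}}:\mathbb F_{2^n}\to\mathbb F_{2^n}$ is defined by $f_{\mathrm{inv}}(x)=x^{-1}$ for $x\ne 0$ and $f_{\mathrm{inv}}(0)=0$. A function $f:\mathbb F_{2^n}\to\mathbb F_{2^n}$ is $k$th order sum-free if $\sum_{x\in A}f(x)\ne 0$ for every $k$-dimensional $\mathbb F_2$-affine subspace $A$ of $\mathbb F_{2^n}$. *)

theory Defs
  imports Complex_Main "HOL-Library.Cardinality" "HOL-Library.Z2"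
begin

definition f_inv :: "'a::field \<Rightarrow> 'a"
  where "f_inv x = (if x = 0 then 0 else inverse x)"

text \<open>
  The two-element field is the library type \<^typ>\<open>bit\<close>; a field of characteristic 2 is a vector
  space over it via the scalar multiplication below.
\<close>

definition F2_scale :: "bit \<Rightarrow> 'a::field \<Rightarrow> 'a"
  where "F2_scale c x = (if c = 0 then 0 else x)"

text \<open>
  The operations of the library locales for modules and vector spaces are applied to
  \<^const>\<open>F2_scale\<close> without an interpretation, because the locale assumptions only hold in
  characteristic 2. They do hold for fields with \<open>2 ^ n\<close> elements:
\<close>

lemma vector_space_F2_scale:
  assumes "CARD('a::{field,finite}) = 2 ^ n"
  shows "vector_space (F2_scale :: bit \<Rightarrow> 'a \<Rightarrow> 'a)"
proof -
  have "(\<Sum>x\<in>(UNIV :: 'a set). x) = (\<Sum>x\<in>(UNIV :: 'a set). x + 1)"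
    by (rule sum.reindex_bij_witness[of _ "\<lambda>x. x + 1" "\<lambda>x. x - 1"]) auto
  also have "\<dots> = (\<Sum>x\<in>(UNIV :: 'a set). x) + of_nat CARD('a)"
    by (simp add: sum.distrib)
  finally have "(of_nat CARD('a) :: 'a) = 0"
    by simp
  then have "(2 :: 'a) = 0"
    by (simp add: assms)
  then have "x + x = 0" for x :: 'a
    by (metis mult_2 mult_zero_left)
  then show ?thesis
    by unfold_locales (auto simp: F2_scale_def)
qed

definition F2_affine_subspace :: "nat \<Rightarrow> 'a::field set \<Rightarrow> bool"
  where "F2_affine_subspace k A \<longleftrightarrow>
    (\<exists>V a. module.subspace F2_scale V \<and> vector_space.dim F2_scale V = k \<and> A = (\<lambda>v. a + v) ` V)"

definition sum_free :: "nat \<Rightarrow> ('a::{field,finite} \<Rightarrow> 'a) \<Rightarrow> bool"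
  where "sum_free k f \<longleftrightarrow> (\<forall>A. F2_affine_subspace k A \<longrightarrow> (\<Sum>x\<in>A. f x) \<noteq> 0)"

end

theory Submission
  imports Defs "HOL-Analysis.Convex" "HOL-Computational_Algebra.Polynomial" "HOL-Library.FuncSet"
begin

text \<open>
  Write \<open>S(V)\<close> for the sum of the inverses of the nonzero elements of a subspace \<open>V\<close>. It is enough to
  find, for each \<open>k\<close> in the given range, a linear subspace of dimension \<open>k\<close> with \<open>S(V) = 0\<close>; such a \<open>k\<close>
  is called a zero-sum dimension below.

  Everything rests on one formula. Let \<open>L(x)\<close> be the product of \<open>x + a\<close> over \<open>a \<in> A\<close>, an additive map with
  kernel \<open>A\<close>, and let \<open>D\<close> be the product of the nonzero elements of \<open>A\<close>. Since \<open>D\<close> is the derivative of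
  the polynomial \<open>L\<close>, the inverses of a coset \<open>x + A\<close> other than \<open>A\<close> sum to \<open>D / L(x)\<close>. Hence
  \<open>S(V) = S(A) + D * S(B)\<close> if \<open>V\<close> is the preimage under \<open>L\<close> of a subspace \<open>B\<close> of the image of \<open>L\<close>
  (lemma \<open>compose_subspaces\<close>). There are three consequences.

  \<^item> Duality: taking the whole image for \<open>B\<close> makes \<open>V\<close> the field, whose inverses sum to 0. So \<open>k\<close> is a
    zero-sum dimension iff \<open>n - k\<close> is, and the second range of \<open>k\<close> is the mirror image of the first.

  \<^item> Addition: if \<open>S(A) = S(B) = 0\<close> and \<open>dim A * dim B < n\<close>, then by pigeonhole some nonzero multiple of
    \<open>B\<close> lies in the image of \<open>L\<close>, and the preimage of it has sum 0 and dimension \<open>dim A + dim B\<close>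
    (lemma \<open>zero_sum_dim_add\<close>). With \<open>dim B = 3\<close> this is a step from \<open>k\<close> to \<open>k + 3\<close> as long as
    \<open>3 * k < n\<close>, which explains the bound \<open>\<lceil>n/3\<rceil> + 2\<close>: only the dimensions 3, 4 and 5 remain.

  \<^item> Conics: if \<open>A\<close> is spanned by \<open>a\<close> and \<open>b\<close>, the image of \<open>L\<close> consists of the \<open>(D * c)\<^sup>2\<close> with \<open>c\<close>
    orthogonal to \<open>A\<close> for the trace form. So a subspace \<open>C\<close> orthogonal to \<open>a\<close> and \<open>b\<close> with
    \<open>a\<^sup>2 + a * b + b\<^sup>2 = S(C)\<^sup>2\<close> yields the zero-sum dimension \<open>dim C + 2\<close>
    (lemma \<open>zero_sum_dim_from_orthogonal_pair\<close>). For fixed \<open>C\<close> such pairs are counted with additive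
    characters, and the sum of a character over the conic is, up to sign, a Kloosterman sum \<open>K(c)\<close>,
    the sum of \<open>chi (x + c / x)\<close> over \<open>x \<noteq> 0\<close>.

  Let \<open>q = 2 ^ n\<close>. For dimension 3 only \<open>K(1)\<close> occurs, and an estimate of order \<open>q\<close> to the power \<open>3/4\<close> suffices. For
  dimensions 4 and 5 with \<open>n\<close> odd, \<open>C\<close> runs through the extensions of a fixed subspace by one element \<open>z\<close>;
  as the arguments of the Kloosterman sums are rational functions of \<open>z\<close> of small degree, the
  Cauchy-Schwarz inequality and the second moment of the Kloosterman sums bound their average
  (lemma \<open>zero_sum_dim_by_averaging\<close>). This works for \<open>n \<ge> 11\<close> and \<open>n \<ge> 17\<close>, respectively. For even \<open>n\<close> the
  four-element subfield and the addition step give 4 and 5. The remaining odd \<open>n\<close> are settled by duality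
  (dimension 5 for \<open>n = 9\<close> and \<open>n = 11\<close>) and by explicit subspaces (dimension 4 for \<open>n = 9\<close>, dimension 5
  for \<open>n = 13\<close> and \<open>n = 15\<close>).
\<close>

section \<open>Binary fields and their subspaces\<close>

text \<open>
  The theorem speaks about a field type, so the size is imposed on a type through its
  \<open>itself\<close> token.
\<close>

locale binary_field =
  fixes n :: nat and ty :: "'a::{field,finite} itself"
  assumes card_field: "CARD('a) = 2 ^ n"
begin

sublocale F2: vector_space "F2_scale :: bit \<Rightarrow> 'a \<Rightarrow> 'a"
  using card_field by (rule vector_space_F2_scale)

lemma add_self [simp]: "x + x = 0" for x :: 'a
proof -
  have "x + x = F2_scale 1 x + F2_scale 1 x" by (simp add: F2_scale_def)
  also have "\<dots> = F2_scale (1 + 1) x" by (rule F2.scale_left_distrib [symmetric])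
  also have "\<dots> = 0" by (simp add: F2_scale_def)
  finally show ?thesis .
qed

lemma add_self_left [simp]: "x + (x + y) = y" for x y :: 'a
  by (simp add: add.assoc [symmetric])

lemma uminus_eq [simp]: "- x = x" for x :: 'a
  by (metis add_self minus_unique)

lemma minus_eq [simp]: "x - y = x + y" for x y :: 'a
  by (metis add_uminus_conv_diff uminus_eq)

lemma add_eq_0 [simp]: "x + y = 0 \<longleftrightarrow> x = y" for x y :: 'a
  by (metis add_self add_self_left add.right_neutral)

lemma two_eq_0 [simp]: "(2::'a) = 0"
  using add_self [of 1] by (simp only: one_add_one)

lemma square_add: "(x + y)\<^sup>2 = x\<^sup>2 + y\<^sup>2" for x y :: 'a
  by (simp add: power2_sum)

lemma square_inj [simp]: "x\<^sup>2 = y\<^sup>2 \<longleftrightarrow> x = y" for x y :: 'a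
  by (metis add_eq_0 square_add zero_eq_power2)

lemma bij_square: "bij (\<lambda>x :: 'a. x\<^sup>2)"
  by (simp add: finite_UNIV_inj_surj bij_def inj_def)

lemma subspace_iff: "F2.subspace A \<longleftrightarrow> 0 \<in> A \<and> (\<forall>x\<in>A. \<forall>y\<in>A. x + y \<in> A)"
  by (auto simp: F2.subspace_def F2_scale_def)

lemma subspace_add_iff: "F2.subspace A \<Longrightarrow> x \<in> A \<Longrightarrow> x + y \<in> A \<longleftrightarrow> y \<in> A"
  by (metis subspace_iff add_self_left)

lemma subspace_add_iff': "F2.subspace A \<Longrightarrow> y \<in> A \<Longrightarrow> x + y \<in> A \<longleftrightarrow> x \<in> A"
  by (metis subspace_add_iff add.commute)

lemma span_insert_eq: "F2.span (insert w B) = F2.span B \<union> (+) w ` F2.span B"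
proof -
  have "x \<in> F2.span (insert w B) \<longleftrightarrow> x \<in> F2.span B \<or> x + w \<in> F2.span B" for x
  proof -
    have "x \<in> F2.span (insert w B) \<longleftrightarrow> (\<exists>k. x - F2_scale k w \<in> F2.span B)"
      by (rule F2.span_breakdown_eq)
    also have "\<dots> \<longleftrightarrow> (\<exists>k\<in>{0, 1}. x - F2_scale k w \<in> F2.span B)"
    proof -
      have "k = 0 \<or> k = 1" for k :: bit by (cases k) auto
      then show ?thesis by blast
    qed
    finally show ?thesis by (simp add: F2_scale_def)
  qed
  moreover have "x + w \<in> F2.span B \<longleftrightarrow> x \<in> (+) w ` F2.span B" for x
    by (force simp: image_iff add.commute)
  ultimately show ?thesis by blast
qed

lemma subspace_extend_disjoint: "F2.subspace A \<Longrightarrow> w \<notin> A \<Longrightarrow> A \<inter> (+) w ` A = {}"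
  by (auto simp: subspace_add_iff')

lemma subspace_extend:
  assumes "F2.subspace A"
  shows "F2.subspace (A \<union> (+) w ` A)"
  by (metis F2.span_eq_iff F2.subspace_span assms span_insert_eq)

text \<open>
  Choosing a basis, every subspace is reached from \<open>{0}\<close> by adjoining one new vector at
  a time, that is, by adding a disjoint coset.
\<close>

lemma subspace_induct [consumes 1, case_names zero extend]:
  assumes A: "F2.subspace A" and 0: "P {0}"
    and step: "\<And>A w. F2.subspace A \<Longrightarrow> w \<notin> A \<Longrightarrow> P A \<Longrightarrow> P (A \<union> (+) w ` A)"
  shows "P A"
proof -
  obtain B where B: "F2.independent B" "F2.span B = A"
    by (metis A F2.basis_exists F2.span_eq_iff F2.span_mono subset_antisym)
  have "finite B" by simp
  then have "F2.independent B \<Longrightarrow> P (F2.span B)"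
  proof induction
    case empty
    then show ?case using 0 by simp
  next
    case (insert w B)
    then have "w \<notin> F2.span B" "F2.independent B"
      by (simp_all add: F2.independent_insert)
    then show ?case using step insert by (simp add: span_insert_eq)
  qed
  then show ?thesis using B by simp
qed

lemma card_extend:
  assumes "F2.subspace A" "w \<notin> A"
  shows "card (A \<union> (+) w ` A) = 2 * card A"
  using assms by (simp add: card_Un_disjoint subspace_extend_disjoint card_image)

lemma dim_extend:
  assumes "F2.subspace A" "w \<notin> A"
  shows "F2.dim (A \<union> (+) w ` A) = Suc (F2.dim A)"
proof -
  obtain B where B: "F2.independent B" "F2.span B = A" "card B = F2.dim A"
    by (metis assms(1) F2.basis_exists F2.span_eq_iff F2.span_mono subset_antisym)
  then have "F2.independent (insert w B)" "w \<notin> B"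
    using assms by (auto simp: F2.independent_insert F2.span_base)
  then have "F2.dim (F2.span (insert w B)) = Suc (card B)"
    using F2.dim_span_eq_card_independent by fastforce
  then show ?thesis using B by (simp add: span_insert_eq)
qed

lemma card_subspace: "F2.subspace A \<Longrightarrow> card A = 2 ^ F2.dim A"
proof (induction rule: subspace_induct)
  case zero
  have "F2.dim {0} = 0" using F2.dim_eq_card [of "{}" "{0}"] F2.independent_empty by simp
  then show ?case by simp
next
  case (extend A w)
  then show ?case by (simp add: card_extend dim_extend)
qed

lemma dim_eqI: "F2.subspace A \<Longrightarrow> card A = 2 ^ k \<Longrightarrow> F2.dim A = k"
  using card_subspace by simp

lemma dim_UNIV_eq: "F2.dim UNIV = n"
  by (intro dim_eqI) (auto simp: card_field)

section \<open>The polynomial vanishing on a subspace\<close>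

text \<open>
  In characteristic 2 the factor \<open>x + a\<close> is \<open>x - a\<close>, so this is the monic
  polynomial function whose roots are the elements of \<open>A\<close>.
\<close>

definition vanish :: "'a set \<Rightarrow> 'a \<Rightarrow> 'a"
  where "vanish A x = (\<Prod>a\<in>A. x + a)"

text \<open>
  The coefficient of \<open>x\<close> in the additive polynomial that vanishes on \<open>A\<close>,
  and hence its constant derivative.
\<close>

definition slope :: "'a set \<Rightarrow> 'a"
  where "slope A = \<Prod>(A - {0})"

definition inv_sum :: "'a set \<Rightarrow> 'a"
  where "inv_sum A = (\<Sum>a\<in>A. inverse a)"

lemma vanish_eq_0_iff: "F2.subspace A \<Longrightarrow> vanish A x = 0 \<longleftrightarrow> x \<in> A"
  by (auto simp: vanish_def)

lemma slope_nonzero [simp]: "slope A \<noteq> 0"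
  by (simp add: slope_def)

text \<open>
  The elements of the new coset contribute \<open>L(x + w) = L(x) + L(w)\<close>.
\<close>

lemma vanish_extend:
  assumes "F2.subspace A" "w \<notin> A" "\<And>x y. vanish A (x + y) = vanish A x + vanish A y"
  shows "vanish (A \<union> (+) w ` A) x = vanish A x * (vanish A x + vanish A w)"
proof -
  have "vanish (A \<union> (+) w ` A) x = vanish A x * (\<Prod>a\<in>(+) w ` A. x + a)"
    using subspace_extend_disjoint [OF assms(1,2)] unfolding vanish_def
    by (subst prod.union_disjoint) auto
  also have "(\<Prod>a\<in>(+) w ` A. x + a) = vanish A (x + w)"
    by (simp add: prod.reindex vanish_def add.assoc)
  finally show ?thesis using assms by simp
qed

text \<open>
  Induction over the dimension: \<open>L\<close> is replaced by \<open>L\<^sup>2 + L(w) * L\<close>,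
  which is again additive in characteristic 2.
\<close>

lemma vanish_add: "F2.subspace A \<Longrightarrow> vanish A (x + y) = vanish A x + vanish A y"
proof (induction arbitrary: x y rule: subspace_induct)
  case zero
  then show ?case by (simp add: vanish_def)
next
  case (extend A w)
  have "u * (u + c) + v * (v + c) = (u + v) * (u + v + c)" for u v c :: 'a
    using square_add [of u v] by (simp add: algebra_simps power2_eq_square)
  then show ?case using vanish_extend [OF extend(1,2)] extend by simp
qed

lemma slope_extend:
  assumes "F2.subspace A" "w \<notin> A"
  shows "slope (A \<union> (+) w ` A) = slope A * vanish A w"
proof -
  have "0 \<notin> (+) w ` A" using assms by (auto)
  then have "A \<union> (+) w ` A - {0} = (A - {0}) \<union> (+) w ` A" by auto
  moreover have "(A - {0}) \<inter> (+) w ` A = {}" using subspace_extend_disjoint [OF assms] by auto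
  ultimately have "slope (A \<union> (+) w ` A) = slope A * \<Prod>((+) w ` A)"
    by (simp add: slope_def prod.union_disjoint)
  then show ?thesis by (simp add: prod.reindex vanish_def)
qed

text \<open>
  This is the logarithmic derivative \<open>L'/L\<close> of a polynomial \<open>L\<close> with
  constant derivative. The proof by induction adds the contributions \<open>D / L(x)\<close> and
  \<open>D / (L(x) + L(w))\<close> of the two cosets of the smaller subspace.
\<close>

lemma sum_inverse_coset:
  "F2.subspace A \<Longrightarrow> x \<notin> A \<Longrightarrow> (\<Sum>a\<in>A. inverse (x + a)) = slope A / vanish A x"
proof (induction arbitrary: x rule: subspace_induct)
  case zero
  then show ?case by (simp add: vanish_def slope_def inverse_eq_divide)
next
  case (extend A w)
  have x: "x \<notin> A" "x + w \<notin> A" using extend by (force simp: image_iff)+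
  then have nz: "vanish A x \<noteq> 0" "vanish A x + vanish A w \<noteq> 0"
    using extend vanish_eq_0_iff vanish_add by metis+
  have "(\<Sum>a\<in>A \<union> (+) w ` A. inverse (x + a))
      = (\<Sum>a\<in>A. inverse (x + a)) + (\<Sum>a\<in>A. inverse (x + w + a))"
    using subspace_extend_disjoint [OF extend(1,2)]
    by (simp add: sum.union_disjoint sum.reindex add.assoc)
  also have "\<dots> = slope A / vanish A x + slope A / (vanish A x + vanish A w)"
    using x extend by (simp add: vanish_add)
  also have "\<dots> = slope A * vanish A w / (vanish A x * (vanish A x + vanish A w))"
  proof -
    have "slope A * (vanish A x + vanish A w) + slope A * vanish A x = slope A * vanish A w"
      by (simp add: distrib_left add.commute)
    then show ?thesis using nz by (simp add: add_frac_eq)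
  qed
  finally show ?case
    using extend by (simp add: slope_extend vanish_extend vanish_add)
qed

lemma vanish_zero [simp]: "F2.subspace A \<Longrightarrow> vanish A 0 = 0"
  using vanish_eq_0_iff F2.subspace_0 by blast

lemma subspace_vimage_vanish: "F2.subspace A \<Longrightarrow> F2.subspace B \<Longrightarrow> F2.subspace (vanish A -` B)"
  by (simp add: subspace_iff [of B] subspace_iff [of "vanish A -` B"] vanish_add)

lemma subspace_image_vanish: "F2.subspace A \<Longrightarrow> F2.subspace B \<Longrightarrow> F2.subspace (vanish A ` B)"
  unfolding subspace_iff [of B] subspace_iff [of "vanish A ` B"]
  by (auto simp: image_iff simp flip: vanish_add) (metis vanish_zero)

lemma vanish_fibre: "F2.subspace A \<Longrightarrow> {v. vanish A v = vanish A x} = (+) x ` A"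
proof -
  assume A: "F2.subspace A"
  have "vanish A v = vanish A x \<longleftrightarrow> x + v \<in> A" for v
    using A vanish_eq_0_iff vanish_add by (metis add_eq_0)
  then show ?thesis by (force simp: image_iff)
qed

lemma sum_vimage_vanish:
  fixes g :: "'a \<Rightarrow> 'b::comm_monoid_add"
  assumes A: "F2.subspace A"
  shows "(\<Sum>v\<in>vanish A -` B. g v) = (\<Sum>y\<in>B. \<Sum>v | vanish A v = y. g v)"
proof -
  have "(\<Sum>y\<in>B. \<Sum>v | v \<in> vanish A -` B \<and> vanish A v = y. g v) = (\<Sum>v\<in>vanish A -` B. g v)"
    by (rule sum.group) auto
  moreover have "{v. v \<in> vanish A -` B \<and> vanish A v = y} = {v. vanish A v = y}" if "y \<in> B" for y
    using that by auto
  ultimately show ?thesis by simp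
qed

text \<open>
  The fibre of \<open>L\<close> over 0 is \<open>A\<close>, and every other fibre over
  \<open>B\<close> is a coset \<open>x + A\<close> with inverse sum \<open>D / L(x)\<close>; so the
  sum over the preimage is \<open>S(A)\<close> plus \<open>D\<close> times the sum of \<open>1 /
  y\<close> over the nonzero \<open>y \<in> B\<close>.
\<close>

lemma compose_subspaces:
  assumes A: "F2.subspace A" and B: "F2.subspace B" and range: "B \<subseteq> range (vanish A)"
  shows "F2.dim (vanish A -` B) = F2.dim A + F2.dim B"
    and "inv_sum (vanish A -` B) = inv_sum A + slope A * inv_sum B"
proof -
  have "card (vanish A -` B) = (\<Sum>v\<in>vanish A -` B. 1)" by simp
  also have "\<dots> = (\<Sum>y\<in>B. card {v. vanish A v = y})" by (subst sum_vimage_vanish [OF A]) simp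
  also have "\<dots> = (\<Sum>y\<in>B. card A)"
  proof (rule sum.cong)
    fix y assume "y \<in> B"
    then obtain x where "y = vanish A x" using range by auto
    then show "card {v. vanish A v = y} = card A" by (simp add: vanish_fibre A card_image)
  qed simp
  finally have "card (vanish A -` B) = 2 ^ (F2.dim A + F2.dim B)"
    by (simp add: card_subspace A B power_add)
  then show "F2.dim (vanish A -` B) = F2.dim A + F2.dim B"
    by (intro dim_eqI subspace_vimage_vanish A B)
  have fib: "(\<Sum>v | vanish A v = y. inverse v) = (if y = 0 then inv_sum A else slope A * inverse y)"
    if "y \<in> B" for y
  proof -
    obtain x where x: "y = vanish A x" using \<open>y \<in> B\<close> range by blast
    show ?thesis
    proof (cases "y = 0")
      case True
      then show ?thesis using vanish_eq_0_iff [OF A] by (simp add: inv_sum_def)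
    next
      case False
      then have "x \<notin> A" using x vanish_eq_0_iff [OF A] by simp
      then show ?thesis using False
        by (simp add: x vanish_fibre A sum.reindex sum_inverse_coset divide_inverse)
    qed
  qed
  have "inv_sum (vanish A -` B) = (\<Sum>y\<in>B. if y = 0 then inv_sum A else slope A * inverse y)"
    unfolding inv_sum_def [of "vanish A -` B"] by (subst sum_vimage_vanish [OF A]) (simp add: fib)
  also have "\<dots> = inv_sum A + (\<Sum>y\<in>B - {0}. slope A * inverse y)"
    using F2.subspace_0 [OF B] by (subst sum.remove [of _ 0]) auto
  also have "(\<Sum>y\<in>B - {0}. slope A * inverse y) = slope A * inv_sum B"
    unfolding inv_sum_def sum_distrib_left using F2.subspace_0 [OF B]
    by (intro sum.mono_neutral_left) auto
  finally show "inv_sum (vanish A -` B) = inv_sum A + slope A * inv_sum B" .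
qed

lemma dim_range_vanish:
  assumes "F2.subspace A"
  shows "F2.dim A + F2.dim (range (vanish A)) = n"
proof -
  have "vanish A -` range (vanish A) = UNIV" by auto
  then show ?thesis
    using compose_subspaces(1) [OF assms subspace_image_vanish [OF assms F2.subspace_UNIV]]
    by (simp add: dim_UNIV_eq)
qed

section \<open>Duality and addition of zero-sum dimensions\<close>

definition zero_sum_dim :: "nat \<Rightarrow> bool"
  where "zero_sum_dim k \<longleftrightarrow> (\<exists>V. F2.subspace V \<and> F2.dim V = k \<and> inv_sum V = 0)"

lemma zero_sum_dim_imp_not_sum_free:
  assumes "zero_sum_dim k"
  shows "\<not> sum_free k (f_inv :: 'a \<Rightarrow> 'a)"
proof -
  obtain V where V: "F2.subspace V" "F2.dim V = k" "inv_sum V = 0"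
    using assms by (auto simp: zero_sum_dim_def)
  have "V = (\<lambda>v. 0 + v) ` V" by simp
  with V(1,2) have "F2_affine_subspace k V" unfolding F2_affine_subspace_def by blast
  moreover have "(\<Sum>x\<in>V. f_inv x) = inv_sum V"
    unfolding inv_sum_def by (intro sum.cong) (auto simp: f_inv_def)
  ultimately show ?thesis using V(3) unfolding sum_free_def by auto
qed

text \<open>
  The sum is invariant under multiplication by any \<open>c \<noteq> 0\<close>, and some such
  \<open>c\<close> differs from 1.
\<close>

lemma inv_sum_UNIV:
  assumes "n \<ge> 2"
  shows "inv_sum UNIV = 0"
proof -
  have "(2::nat) ^ 2 \<le> 2 ^ n" using assms by (intro power_increasing) auto
  then have "card (UNIV - {0, 1 :: 'a}) \<noteq> 0" by (simp add: card_field card_Diff_subset)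
  then obtain c :: 'a where c: "c \<noteq> 0" "c \<noteq> 1"
    by (metis Diff_iff card.empty ex_in_conv insertCI)
  have "c * inv_sum UNIV = (\<Sum>x\<in>UNIV. c * inverse x)"
    by (simp add: inv_sum_def sum_distrib_left)
  also have "\<dots> = inv_sum UNIV"
    unfolding inv_sum_def
    by (rule sum.reindex_bij_witness [of _ "\<lambda>x. c * x" "\<lambda>x. x / c"])
      (use c in \<open>auto simp: field_simps\<close>)
  finally have "c * inv_sum UNIV = inv_sum UNIV" .
  then show ?thesis using c by auto
qed

lemma zero_sum_dim_dual:
  assumes "zero_sum_dim k" "n \<ge> 2"
  shows "zero_sum_dim (n - k)"
proof -
  obtain V where V: "F2.subspace V" "F2.dim V = k" "inv_sum V = 0"
    using assms by (auto simp: zero_sum_dim_def)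
  let ?W = "range (vanish V)"
  have W: "F2.subspace ?W" using subspace_image_vanish [OF V(1)] by simp
  have "vanish V -` ?W = UNIV" by auto
  then have "slope V * inv_sum ?W = 0"
    using compose_subspaces(2) [OF V(1) W] inv_sum_UNIV [OF assms(2)] V(3) by simp
  moreover have "F2.dim ?W = n - k" using dim_range_vanish [OF V(1)] V(2) by simp
  ultimately show ?thesis unfolding zero_sum_dim_def using W by (metis slope_nonzero mult_eq_0_iff)
qed

lemma subspace_scale: "F2.subspace B \<Longrightarrow> F2.subspace ((*) c ` B)"
proof -
  assume "F2.subspace B"
  moreover have "c * x + c * y \<in> (*) c ` B" if "x + y \<in> B" for x y
    using that by (metis distrib_left imageI)
  ultimately show ?thesis unfolding subspace_iff by (auto simp: image_iff)
qed

text \<open>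
  The condition \<open>c * x \<in> image of L\<close> is the vanishing of an additive function of
  \<open>c\<close> with \<open>2 ^ dim A\<close> values. For all \<open>x\<close> in a basis of
  \<open>B\<close> together there are \<open>2 ^ (dim A * dim B)\<close> possible value tuples,
  fewer than field elements, so two elements have the same tuple, and their difference is the wanted
  factor.
\<close>

lemma exists_scaling:
  assumes A: "F2.subspace A" and B: "F2.subspace B" and lt: "F2.dim A * F2.dim B < n"
  shows "\<exists>c. c \<noteq> 0 \<and> (*) c ` B \<subseteq> range (vanish A)"
proof -
  let ?W = "range (vanish A)"
  have W: "F2.subspace ?W" using subspace_image_vanish [OF A] by simp
  have M: "F2.subspace (range (vanish ?W))" using subspace_image_vanish [OF W] by simp
  have "F2.dim (range (vanish ?W)) = F2.dim A"
    using dim_range_vanish [OF A] dim_range_vanish [OF W] by simp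
  then have cardM: "card (range (vanish ?W)) = 2 ^ F2.dim A" using card_subspace [OF M] by simp
  obtain b where b: "F2.span b = B" "card b = F2.dim B"
    by (metis B F2.basis_exists F2.span_eq_iff F2.span_mono subset_antisym)
  define \<Phi> where "\<Phi> = (\<lambda>c. \<lambda>x\<in>b. vanish ?W (c * x))"
  have "\<Phi> ` UNIV \<subseteq> b \<rightarrow>\<^sub>E range (vanish ?W)" by (auto simp: \<Phi>_def)
  then have "card (\<Phi> ` UNIV) \<le> card (b \<rightarrow>\<^sub>E range (vanish ?W))"
    by (intro card_mono finite_PiE) auto
  also have "\<dots> = 2 ^ (F2.dim A * F2.dim B)"
    by (simp add: card_PiE cardM b(2) power_mult)
  also have "\<dots> < 2 ^ n" using lt by simp
  finally have "\<not> inj \<Phi>" using card_image [of \<Phi> UNIV] by (auto simp: card_field)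
  then obtain c d where cd: "c \<noteq> d" "\<Phi> c = \<Phi> d" by (auto simp: inj_def)
  have "(c + d) * x \<in> ?W" if "x \<in> b" for x
  proof -
    have "vanish ?W (c * x) = vanish ?W (d * x)"
      using cd(2) that unfolding \<Phi>_def by (metis restrict_apply')
    then have "vanish ?W ((c + d) * x) = 0"
      by (simp add: distrib_right vanish_add [OF W])
    then show ?thesis using vanish_eq_0_iff [OF W] by blast
  qed
  then have "b \<subseteq> {x. (c + d) * x \<in> ?W}" by auto
  moreover have "F2.subspace {x. (c + d) * x \<in> ?W}"
    using F2.subspace_0 [OF W] F2.subspace_add [OF W]
    unfolding subspace_iff [of "{x. (c + d) * x \<in> ?W}"] by (simp add: distrib_left)
  ultimately have "B \<subseteq> {x. (c + d) * x \<in> ?W}"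
    using F2.span_minimal b(1) by blast
  then show ?thesis using cd(1) by (intro exI [of _ "c + d"]) auto
qed

lemma inv_sum_scale: "c \<noteq> 0 \<Longrightarrow> inv_sum ((*) c ` B) = inv_sum B / c"
  by (simp add: inv_sum_def sum.reindex inj_on_def sum_distrib_left divide_inverse mult.commute [of _ "inverse c"])

lemma dim_scale: "c \<noteq> 0 \<Longrightarrow> F2.subspace B \<Longrightarrow> F2.dim ((*) c ` B) = F2.dim B"
  using card_subspace [of B]
  by (intro dim_eqI subspace_scale) (simp_all add: card_image inj_on_def)

text \<open>
  Scaling \<open>B\<close> keeps its inverse sum 0, so the preimage of a multiple of
  \<open>B\<close> has inverse sum \<open>0 + D * 0\<close>.
\<close>

lemma zero_sum_dim_add:
  assumes "zero_sum_dim a" "zero_sum_dim b" "a * b < n"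
  shows "zero_sum_dim (a + b)"
proof -
  obtain A where A: "F2.subspace A" "F2.dim A = a" "inv_sum A = 0"
    using assms by (auto simp: zero_sum_dim_def)
  obtain B where B: "F2.subspace B" "F2.dim B = b" "inv_sum B = 0"
    using assms by (auto simp: zero_sum_dim_def)
  obtain c where c: "c \<noteq> 0" "(*) c ` B \<subseteq> range (vanish A)"
    using exists_scaling [OF A(1) B(1)] assms A B by auto
  note cB = subspace_scale [OF B(1), of c]
  show ?thesis unfolding zero_sum_dim_def
  proof (intro exI conjI)
    show "F2.subspace (vanish A -` (*) c ` B)" by (rule subspace_vimage_vanish [OF A(1) cB])
    show "F2.dim (vanish A -` (*) c ` B) = a + b"
      using compose_subspaces(1) [OF A(1) cB c(2)] A B c by (simp add: dim_scale)
    show "inv_sum (vanish A -` (*) c ` B) = 0"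
      using compose_subspaces(2) [OF A(1) cB c(2)] A B c by (simp add: inv_sum_scale)
  qed
qed

section \<open>The trace and the additive character\<close>

lemma n_pos: "n > 0"
proof (rule ccontr)
  assume "\<not> n > 0"
  then have "card {0, 1 :: 'a} \<le> 1" using card_field card_mono [of UNIV "{0, 1 :: 'a}"] by simp
  then show False by simp
qed

lemma power_field_size: "x ^ (2 ^ n) = x" for x :: 'a
proof (cases "x = 0")
  case True
  then show ?thesis by simp
next
  case False
  let ?U = "UNIV - {0 :: 'a}"
  have card: "card ?U = 2 ^ n - 1" by (simp add: card_field card_Diff_subset)
  have "\<Prod>?U = (\<Prod>y\<in>?U. x * y)"
    by (rule prod.reindex_bij_witness [of _ "\<lambda>y. x * y" "\<lambda>y. y / x"]) (use False in auto)
  also have "\<dots> = x ^ (2 ^ n - 1) * \<Prod>?U" by (simp add: prod.distrib card)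
  finally have "x ^ (2 ^ n - 1) = 1" by simp
  moreover have "(2::nat) ^ n = Suc (2 ^ n - 1)" by simp
  ultimately show ?thesis by (metis mult.right_neutral power_Suc)
qed

lemma frobenius_add: "(x + y) ^ (2 ^ i) = x ^ (2 ^ i) + y ^ (2 ^ i)" for x y :: 'a
proof (induction i)
  case (Suc i)
  have double: "z ^ (2 ^ Suc i) = (z ^ (2 ^ i))\<^sup>2" for z :: 'a
    by (simp flip: power_mult add: mult.commute)
  show ?case unfolding double Suc.IH by (rule square_add)
qed simp

text \<open>
  The absolute trace, with its values 0 and 1 taken in the field itself.
\<close>

definition tr :: "'a \<Rightarrow> 'a"
  where "tr x = (\<Sum>i<n. x ^ (2 ^ i))"

lemma tr_add: "tr (x + y) = tr x + tr y"
  by (simp add: tr_def frobenius_add sum.distrib)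

lemma tr_zero [simp]: "tr 0 = 0"
  using tr_add [of 0 0] by simp

lemma tr_square [simp]: "tr (x\<^sup>2) = tr x"
proof -
  have "tr (x\<^sup>2) + x = (\<Sum>i<n. x ^ (2 ^ Suc i)) + x ^ (2 ^ 0)"
    by (simp add: tr_def power_mult)
  also have "\<dots> = (\<Sum>i<Suc n. x ^ (2 ^ i))"
    by (subst sum.lessThan_Suc_shift) (simp add: add.commute)
  also have "\<dots> = tr x + x" by (simp add: tr_def power_field_size)
  finally show ?thesis by simp
qed

lemma square_tr: "(tr x)\<^sup>2 = tr x"
proof -
  have "(\<Sum>i\<in>I. f i)\<^sup>2 = (\<Sum>i\<in>I. (f i)\<^sup>2)" if "finite I" for f :: "nat \<Rightarrow> 'a" and I
    using that by induction (simp_all add: square_add)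
  then have "(tr x)\<^sup>2 = (\<Sum>i<n. (x\<^sup>2) ^ (2 ^ i))"
    by (simp add: tr_def flip: power_mult) (simp add: mult.commute)
  then show ?thesis using tr_square by (simp add: tr_def)
qed

lemma tr_cases: "tr x = 0 \<or> tr x = 1"
  using square_tr [of x] by (simp add: power2_eq_square)

lemma tr_one: "tr 1 = of_nat n"
  by (simp add: tr_def)

lemma of_nat_parity: "(of_nat m :: 'a) = (if even m then 0 else 1)"
  by (induction m) auto

lemma subspace_F2: "F2.subspace {0, 1}"
  by (auto simp: subspace_iff)

lemma dim_F2: "F2.dim {0, 1} = 1"
  using subspace_F2 by (rule dim_eqI) simp

lemma vanish_F2: "vanish {0, 1} x = x\<^sup>2 + x"
  by (simp add: vanish_def power2_eq_square distrib_left)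

lemma card_tr_zero: "card {x. tr x = 0} \<le> 2 ^ (n - 1)"
proof -
  define p :: "'a poly" where "p = (\<Sum>i<n. monom 1 (2 ^ i))"
  have poly: "poly p x = tr x" for x
    by (simp add: p_def tr_def poly_sum poly_monom)
  have "coeff p (2 ^ 0) = (\<Sum>i<n. if i = 0 then 1 else 0)"
    unfolding p_def coeff_sum by (intro sum.cong) auto
  then have "p \<noteq> 0" using n_pos by auto
  moreover have "degree p \<le> 2 ^ (n - 1)"
    unfolding p_def
  proof (intro degree_sum_le)
    fix i assume "i \<in> {..<n}"
    then have "(2::nat) ^ i \<le> 2 ^ (n - 1)" by (intro power_increasing) auto
    then show "degree (monom (1::'a) (2 ^ i)) \<le> 2 ^ (n - 1)"
      using degree_monom_le order_trans by blast
  qed simp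
  ultimately show ?thesis
    using card_poly_roots_bound [of p] by (simp add: poly)
qed

text \<open>
  The map \<open>y \<mapsto> y\<^sup>2 + y\<close> is the polynomial vanishing on \<open>{0,
  1}\<close>, so its image has \<open>2 ^ (n - 1)\<close> elements. They all have trace 0, and there
  cannot be more elements of trace 0 than the degree of the trace polynomial.
\<close>

lemma tr_eq_0_iff: "tr x = 0 \<longleftrightarrow> (\<exists>y. y\<^sup>2 + y = x)"
proof -
  let ?R = "range (vanish {0, 1})"
  have R: "F2.subspace ?R" using subspace_image_vanish [OF subspace_F2] by simp
  have "F2.dim ?R = n - 1" using dim_range_vanish [OF subspace_F2] by (simp add: dim_F2)
  then have "card ?R = 2 ^ (n - 1)" using card_subspace [OF R] by simp
  moreover have "?R \<subseteq> {x. tr x = 0}" by (auto simp: vanish_F2 tr_add)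
  ultimately have "?R = {x. tr x = 0}" using card_tr_zero by (intro card_seteq) auto
  then show ?thesis by (simp add: vanish_F2 image_iff set_eq_iff) metis
qed

definition chi :: "'a \<Rightarrow> real"
  where "chi x = (if tr x = 0 then 1 else - 1)"

lemma chi_zero [simp]: "chi 0 = 1"
  by (simp add: chi_def)

lemma chi_add: "chi (x + y) = chi x * chi y"
  using tr_cases [of x] tr_cases [of y] by (auto simp: chi_def tr_add)

lemma chi_square [simp]: "chi (x\<^sup>2) = chi x"
  by (simp add: chi_def)

lemma chi_cases: "chi x = 1 \<or> chi x = - 1"
  by (simp add: chi_def)

lemma sum_chi_subspace:
  assumes "F2.subspace C"
  shows "(\<Sum>c\<in>C. chi (c * x)) = (if \<forall>c\<in>C. chi (c * x) = 1 then card C else 0)"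
proof (cases "\<forall>c\<in>C. chi (c * x) = 1")
  case False
  then obtain d where d: "d \<in> C" "chi (d * x) = - 1" using chi_cases by blast
  have "(\<Sum>c\<in>C. chi (c * x)) = (\<Sum>c\<in>C. chi ((d + c) * x))"
    by (rule sum.reindex_bij_witness [of _ "\<lambda>c. d + c" "\<lambda>c. d + c"])
      (use d assms in \<open>auto simp: subspace_add_iff\<close>)
  also have "\<dots> = - (\<Sum>c\<in>C. chi (c * x))"
    using d by (simp add: distrib_right chi_add sum_negf)
  finally show ?thesis using False by auto
qed auto

lemma sum_chi: "(\<Sum>c\<in>UNIV. chi (c * x)) = (if x = 0 then 2 ^ n else 0)"
proof -
  have "\<exists>c. chi (c * x) \<noteq> 1" if "x \<noteq> 0"
  proof (rule ccontr)
    assume "\<nexists>c. chi (c * x) \<noteq> 1"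
    then have "tr c = 0" for c
      using that by (metis chi_def nonzero_eq_divide_eq one_neq_neg_one)
    then have "card (UNIV :: 'a set) \<le> 2 ^ (n - 1)" using card_tr_zero by simp
    then show False using n_pos by (simp add: card_field)
  qed
  then show ?thesis
    using sum_chi_subspace [OF F2.subspace_UNIV, of x] by (auto simp: card_field)
qed

lemma sum_chi_nonzero: "(\<Sum>x\<in>UNIV - {0}. chi x) = - 1"
  using sum_chi [of 1] by (simp add: sum_diff1)

text \<open>
  Dividing by \<open>b\<^sup>2\<close> turns the equation into \<open>y\<^sup>2 + y = c /
  b\<^sup>2\<close>, whose solutions come in pairs \<open>y\<close>, \<open>y + 1\<close>.
\<close>

lemma card_artin_schreier:
  assumes "b \<noteq> 0"
  shows "real (card {x. x\<^sup>2 + b * x = c}) = 1 + chi (c / b\<^sup>2)"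
proof -
  have eq: "x\<^sup>2 + b * x = c \<longleftrightarrow> (x / b)\<^sup>2 + x / b = c / b\<^sup>2" for x
    using assms by (simp add: field_simps power2_eq_square)
  show ?thesis
  proof (cases "tr (c / b\<^sup>2) = 0")
    case True
    then obtain y where y: "y\<^sup>2 + y = c / b\<^sup>2" by (auto simp: tr_eq_0_iff)
    have "z\<^sup>2 + z = y\<^sup>2 + y \<longleftrightarrow> z = y \<or> z = y + 1" for z
    proof -
      have "(z\<^sup>2 + z) + (y\<^sup>2 + y) = (z + y) * (z + (y + 1))"
        using square_add [of z y] by (simp add: algebra_simps power2_eq_square)
      then show ?thesis by (metis add_eq_0 mult_eq_0_iff)
    qed
    then have "x\<^sup>2 + b * x = c \<longleftrightarrow> x / b = y \<or> x / b = y + 1" for x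
      by (simp only: eq y [symmetric])
    then have "{x. x\<^sup>2 + b * x = c} = {b * y, b * (y + 1)}"
      using assms by (simp add: set_eq_iff divide_eq_eq mult.commute)
    moreover have "b * y \<noteq> b * (y + 1)" using assms by simp
    ultimately show ?thesis using True by (simp add: chi_def)
  next
    case False
    then have "{x. x\<^sup>2 + b * x = c} = {}" by (auto simp: eq tr_eq_0_iff)
    then show ?thesis using False by (simp add: chi_def)
  qed
qed

section \<open>Kloosterman sums\<close>

definition kloosterman :: "'a \<Rightarrow> real"
  where "kloosterman c = (\<Sum>x\<in>UNIV - {0}. chi (x + c / x))"

lemma kloosterman_square: "kloosterman (c\<^sup>2) = kloosterman c"
proof -
  have "kloosterman c = (\<Sum>x\<in>UNIV - {0}. chi ((x + c / x)\<^sup>2))"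
    by (simp add: kloosterman_def)
  also have "\<dots> = (\<Sum>x\<in>UNIV - {0}. chi (x\<^sup>2 + c\<^sup>2 / x\<^sup>2))"
    by (simp add: square_add power_divide)
  also have "\<dots> = kloosterman (c\<^sup>2)"
    unfolding kloosterman_def
  proof (rule sum.reindex_bij_betw)
    let ?U = "UNIV - {0 :: 'a}"
    have "inj_on (\<lambda>x. x\<^sup>2) ?U" by (simp add: inj_on_def)
    moreover from this have "(\<lambda>x. x\<^sup>2) ` ?U = ?U" by (intro endo_inj_surj) auto
    ultimately show "bij_betw (\<lambda>x. x\<^sup>2) ?U ?U" by (simp add: bij_betw_def)
  qed
  finally show ?thesis by simp
qed

lemma sum_chi_kloosterman:
  assumes "r \<noteq> 0"
  shows "(\<Sum>x\<in>UNIV - {0}. chi (r * x + s / x)) = kloosterman (r * s)"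
  unfolding kloosterman_def
  by (rule sum.reindex_bij_witness [of _ "\<lambda>x. x / r" "\<lambda>x. r * x"]) (use assms in auto)

text \<open>
  Expanding the square and summing over \<open>c\<close> first leaves only the diagonal \<open>x =
  y\<close>.
\<close>

lemma sum_kloosterman_squared: "(\<Sum>c\<in>UNIV. (kloosterman c)\<^sup>2) \<le> (2 ^ n)\<^sup>2"
proof -
  let ?U = "UNIV - {0 :: 'a}"
  have "(\<Sum>c\<in>UNIV. (kloosterman c)\<^sup>2)
      = (\<Sum>c\<in>UNIV. \<Sum>x\<in>?U. \<Sum>y\<in>?U. chi (x + y) * chi (c * (1 / x + 1 / y)))"
    unfolding kloosterman_def power2_eq_square sum_product
    by (intro sum.cong refl) (simp add: distrib_left chi_add mult_ac)
  also have "\<dots> = (\<Sum>x\<in>?U. \<Sum>y\<in>?U. chi (x + y) * (\<Sum>c\<in>UNIV. chi (c * (1 / x + 1 / y))))"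
    unfolding sum_distrib_left by (subst sum.swap, intro sum.cong refl sum.swap)
  also have "\<dots> = (\<Sum>x\<in>?U. \<Sum>y\<in>?U. if x = y then 2 ^ n else 0)"
    by (intro sum.cong refl) (auto simp: sum_chi)
  also have "\<dots> = real (card ?U) * 2 ^ n" by simp
  also have "\<dots> \<le> (2 ^ n)\<^sup>2"
    by (simp add: card_field power2_eq_square card_Diff_subset)
  finally show ?thesis .
qed

text \<open>
  The substitute for pointwise bounds: along a function that takes each value at most
  \<open>D\<close> times, the second moment grows by a factor of at most \<open>D\<close>, and
  Cauchy-Schwarz passes to first moments.
\<close>

lemma sum_abs_kloosterman_le:
  fixes Z :: "'a set"
  assumes "\<And>v. card {z \<in> Z. f z = v} \<le> D"
  shows "(\<Sum>z\<in>Z. \<bar>kloosterman (f z)\<bar>) \<le> sqrt D * 2 ^ n * sqrt (2 ^ n)"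
proof -
  have "(\<Sum>z\<in>Z. (kloosterman (f z))\<^sup>2) = (\<Sum>v\<in>UNIV. \<Sum>z | z \<in> Z \<and> f z = v. (kloosterman (f z))\<^sup>2)"
    by (rule sum.group [symmetric]) auto
  also have "\<dots> = (\<Sum>v\<in>UNIV. card {z \<in> Z. f z = v} * (kloosterman v)\<^sup>2)"
    by (intro sum.cong) auto
  also have "\<dots> \<le> (\<Sum>v\<in>UNIV. D * (kloosterman v)\<^sup>2)"
    using assms by (intro sum_mono mult_right_mono) auto
  also have "\<dots> \<le> D * (2 ^ n)\<^sup>2"
    using sum_kloosterman_squared by (simp add: sum_distrib_left [symmetric] mult_left_mono)
  finally have *: "(\<Sum>z\<in>Z. (kloosterman (f z))\<^sup>2) \<le> D * (2 ^ n)\<^sup>2" .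
  have "(\<Sum>z\<in>Z. \<bar>kloosterman (f z)\<bar> * 1)\<^sup>2 \<le> (\<Sum>z\<in>Z. \<bar>kloosterman (f z)\<bar>\<^sup>2) * (\<Sum>z\<in>Z. 1\<^sup>2)"
    by (rule Cauchy_Schwarz_ineq_sum)
  also have "\<dots> \<le> (real D * (2 ^ n)\<^sup>2) * 2 ^ n"
  proof (intro mult_mono)
    have "card Z \<le> 2 ^ n" using card_mono [of UNIV Z] by (simp add: card_field)
    then have "real (card Z) \<le> real (2 ^ n)" by (simp only: of_nat_le_iff)
    then show "(\<Sum>z\<in>Z. 1\<^sup>2) \<le> (2 ^ n :: real)" by simp
  qed (use * in auto)
  also have "\<dots> = (sqrt D * 2 ^ n * sqrt (2 ^ n))\<^sup>2"
    by (simp add: power_mult_distrib)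
  finally have "(\<Sum>z\<in>Z. \<bar>kloosterman (f z)\<bar> * 1) \<le> sqrt D * 2 ^ n * sqrt (2 ^ n)"
    by (rule power2_le_imp_le) simp
  then show ?thesis by simp
qed

section \<open>Character sums over a conic\<close>

text \<open>
  The norm form of the quadratic extension generated by a root of \<open>X\<^sup>2 + X + 1\<close>,
  if that polynomial is irreducible.
\<close>

definition qf :: "'a \<Rightarrow> 'a \<Rightarrow> 'a"
  where "qf a b = a\<^sup>2 + a * b + b\<^sup>2"

definition conic :: "'a \<Rightarrow> ('a \<times> 'a) set"
  where "conic s = {(a, b). qf a b = s\<^sup>2}"

lemma square_surj: obtains r :: 'a where "r\<^sup>2 = x"
  using bij_square by (metis bij_pointE)

text \<open>
  For \<open>b \<noteq> 0\<close> the points above \<open>b\<close> are the solutions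
  \<open>a\<close> of a quadratic equation, counted by \<open>1 + chi (1 + (s / b)\<^sup>2) = 1 +
  chi 1 * chi (s / b)\<close>; above \<open>b = 0\<close> there is the single point \<open>a =
  s\<close>.
\<close>

lemma sum_conic_snd:
  fixes f :: "'a \<Rightarrow> real"
  assumes "s \<noteq> 0"
  shows "(\<Sum>(a, b)\<in>conic s. f b) = f 0 + (\<Sum>b\<in>UNIV - {0}. f b * (1 + chi 1 * chi (s / b)))"
proof -
  let ?F = "\<lambda>b. {a. a\<^sup>2 + b * a = b\<^sup>2 + s\<^sup>2}"
  have "qf a b = s\<^sup>2 \<longleftrightarrow> a \<in> ?F b" for a b
  proof -
    have "qf a b + s\<^sup>2 = (a\<^sup>2 + b * a) + (b\<^sup>2 + s\<^sup>2)" by (simp add: qf_def algebra_simps)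
    then have "qf a b + s\<^sup>2 = 0 \<longleftrightarrow> (a\<^sup>2 + b * a) + (b\<^sup>2 + s\<^sup>2) = 0" by (simp only:)
    then show ?thesis by (simp only: add_eq_0 mem_Collect_eq)
  qed
  then have "(\<Sum>(a, b)\<in>conic s. f b) = (\<Sum>(b, a)\<in>Sigma UNIV ?F. f b)"
    by (intro sum.reindex_bij_witness [of _ prod.swap prod.swap]) (auto simp: conic_def)
  also have "\<dots> = (\<Sum>b\<in>UNIV. f b * card (?F b))"
    by (subst sum.Sigma [symmetric]) (simp_all add: mult.commute)
  also have "\<dots> = f 0 * card (?F 0) + (\<Sum>b\<in>UNIV - {0}. f b * card (?F b))"
    by (rule sum.remove) auto
  also have "?F 0 = {s}" by auto
  also have "(\<Sum>b\<in>UNIV - {0}. f b * card (?F b))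
      = (\<Sum>b\<in>UNIV - {0}. f b * (1 + chi 1 * chi (s / b)))"
  proof (rule sum.cong)
    fix b :: 'a assume "b \<in> UNIV - {0}"
    then have b: "b \<noteq> 0" by simp
    have "(b\<^sup>2 + s\<^sup>2) / b\<^sup>2 = 1 + (s / b)\<^sup>2"
      using b by (simp add: add_divide_distrib power_divide)
    then have "real (card (?F b)) = 1 + chi 1 * chi (s / b)"
      using card_artin_schreier [OF b] by (simp add: chi_add)
    then show "f b * card (?F b) = f b * (1 + chi 1 * chi (s / b))" by simp
  qed simp
  finally show ?thesis by simp
qed

lemma sum_chi_inverse:
  assumes "s \<noteq> 0"
  shows "(\<Sum>b\<in>UNIV - {0}. chi (s / b)) = - 1"
proof -
  have "(\<Sum>b\<in>UNIV - {0}. chi (s / b)) = (\<Sum>x\<in>UNIV - {0}. chi x)"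
    by (rule sum.reindex_bij_witness [of _ "\<lambda>x. s / x" "\<lambda>x. s / x"]) (use assms in auto)
  then show ?thesis by (simp add: sum_chi_nonzero)
qed

lemma card_conic:
  assumes "s \<noteq> 0"
  shows "real (card (conic s)) = 2 ^ n - chi 1"
proof -
  have "real (card (conic s)) = (\<Sum>(a, b)\<in>conic s. 1)" by simp
  also have "\<dots> = 1 + (\<Sum>b\<in>UNIV - {0}. 1 + chi 1 * chi (s / b))"
    using sum_conic_snd [OF assms, of "\<lambda>_. 1"] by simp
  also have "\<dots> = 1 + (real (card (UNIV - {0 :: 'a})) + chi 1 * (- 1))"
    unfolding sum.distrib sum_distrib_left [symmetric] sum_chi_inverse [OF assms] by simp
  finally show ?thesis by (simp add: card_field card_Diff_subset)
qed

lemma sum_chi_conic_snd: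
  assumes "s \<noteq> 0" "r \<noteq> 0"
  shows "(\<Sum>(a, b)\<in>conic s. chi (r * b)) = chi 1 * kloosterman (r * s)"
proof -
  have "(\<Sum>b\<in>UNIV - {0}. chi (r * b)) = (\<Sum>x\<in>UNIV - {0}. chi x)"
    by (rule sum.reindex_bij_witness [of _ "\<lambda>x. x / r" "\<lambda>x. r * x"]) (use assms in auto)
  moreover have "(\<Sum>b\<in>UNIV - {0}. chi (r * b) * (1 + chi 1 * chi (s / b)))
      = (\<Sum>b\<in>UNIV - {0}. chi (r * b)) + chi 1 * (\<Sum>b\<in>UNIV - {0}. chi (r * b + s / b))"
    by (simp add: sum.distrib sum_distrib_left chi_add distrib_left mult_ac)
  ultimately show ?thesis
    using sum_conic_snd [OF assms(1), of "\<lambda>b. chi (r * b)"]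
    by (simp add: sum_chi_nonzero sum_chi_kloosterman [OF assms(2)])
qed

text \<open>
  Multiplication by an element \<open>u + v * \<omega>\<close> of norm 1, where
  \<open>\<omega>\<^sup>2 = \<omega> + 1\<close>, permutes the conic. With \<open>r\<^sup>2 = qf p
  q\<close>, a suitable such element carries the linear form \<open>p * a + q * b\<close> to
  \<open>r * b\<close>. The maps are written in coordinates, so the argument applies whether or not
  the field contains \<open>\<omega>\<close>.
\<close>

lemma sum_chi_conic:
  assumes "s \<noteq> 0" "qf p q \<noteq> 0"
  shows "(\<Sum>(a, b)\<in>conic s. chi (p * a + q * b)) = chi 1 * kloosterman (qf p q * s\<^sup>2)"
proof -
  obtain r where r: "r\<^sup>2 = qf p q" using square_surj by blast
  then have "r \<noteq> 0" using assms by auto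
  define u v where "u = (p + q) / r" and "v = p / r"
  have "u\<^sup>2 + u * v + v\<^sup>2 = qf p q / r\<^sup>2"
    using \<open>r \<noteq> 0\<close> by (simp add: u_def v_def qf_def field_simps power2_eq_square)
  then have uv: "u\<^sup>2 + u * v + v\<^sup>2 = 1" using r assms by simp
  have norm: "qf (a * x + b * y) (a * y + b * (x + y)) = qf a b * (x\<^sup>2 + x * y + y\<^sup>2)"
    for a b x y by (simp add: qf_def algebra_simps power2_eq_square)
  have inv: "(a * x + b * y) * (x + y) + (a * y + b * (x + y)) * y = a * (x\<^sup>2 + x * y + y\<^sup>2)"
    "(a * x + b * y) * y + (a * y + b * (x + y)) * x = b * (x\<^sup>2 + x * y + y\<^sup>2)"
    for a b x y :: 'a by (simp_all add: algebra_simps power2_eq_square)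
  have uv': "(u + v)\<^sup>2 + (u + v) * v + v\<^sup>2 = 1" "u + v + v = u"
    using uv by (simp_all add: algebra_simps power2_eq_square)
  \<comment> \<open>Multiplication by \<open>u + v * \<omega>\<close>, and by its conjugate \<open>(u + v) + v * \<omega>\<close>, which is its inverse.\<close>
  define f where "f = (\<lambda>(a, b). (a * u + b * v, a * v + b * (u + v)))"
  define g where "g = (\<lambda>(a, b). (a * (u + v) + b * v, a * v + b * u))"
  have gf: "g (f ab) = ab" "f ab \<in> conic s" if "ab \<in> conic s" for ab
    using inv [of "fst ab" u "snd ab" v] norm [of "fst ab" u "snd ab" v] uv that
    by (auto simp: f_def g_def conic_def split: prod.splits)
  have fg: "f (g ab) = ab" "g ab \<in> conic s" if "ab \<in> conic s" for ab
    using inv [of "fst ab" "u + v" "snd ab" v] norm [of "fst ab" "u + v" "snd ab" v] uv' that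
    by (auto simp: f_def g_def conic_def split: prod.splits)
  have "r * (a * v + b * (u + v)) = p * a + q * b" for a b
    using \<open>r \<noteq> 0\<close> by (simp add: u_def v_def field_simps)
  then have "(\<Sum>(a, b)\<in>conic s. chi (p * a + q * b)) = (\<Sum>(a, b)\<in>conic s. chi (r * b))"
    by (intro sum.reindex_bij_witness [of _ g f] gf fg) (auto simp: f_def)
  also have "\<dots> = chi 1 * kloosterman (r * s)"
    using assms \<open>r \<noteq> 0\<close> by (simp add: sum_chi_conic_snd)
  also have "kloosterman (r * s) = kloosterman (qf p q * s\<^sup>2)"
    by (metis kloosterman_square power_mult_distrib r)
  finally show ?thesis .
qed

text \<open>
  Elements \<open>x\<close> and \<open>y\<close> are orthogonal for the trace form if \<open>chi (x
  * y) = 1\<close>.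
\<close>

definition orthogonal_pairs :: "'a set \<Rightarrow> 'a \<Rightarrow> ('a \<times> 'a) set"
  where "orthogonal_pairs C s =
    {(a, b) \<in> conic s. (\<forall>c\<in>C. chi (c * a) = 1) \<and> (\<forall>c\<in>C. chi (c * b) = 1)}"

text \<open>
  Orthogonality to \<open>C\<close> is detected by averaging \<open>chi (p * a)\<close> over
  \<open>p \<in> C\<close>. After exchanging the sums, the pair \<open>(0, 0)\<close> contributes
  the number of points of the conic and every other pair a Kloosterman sum.
\<close>

lemma card_orthogonal_pairs:
  assumes C: "F2.subspace C" and "s \<noteq> 0"
    and aniso: "\<And>p q. p \<in> C \<Longrightarrow> q \<in> C \<Longrightarrow> qf p q = 0 \<Longrightarrow> p = 0 \<and> q = 0"
  shows "real (card (orthogonal_pairs C s)) * (real (card C))\<^sup>2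
    = 2 ^ n - chi 1 + chi 1 * (\<Sum>(p, q)\<in>C \<times> C - {(0, 0)}. kloosterman (qf p q * s\<^sup>2))"
proof -
  have "real (card (orthogonal_pairs C s)) * (real (card C))\<^sup>2
      = (\<Sum>(a, b)\<in>orthogonal_pairs C s. (real (card C))\<^sup>2)" by simp
  also have "\<dots> = (\<Sum>(a, b)\<in>conic s. (\<Sum>p\<in>C. chi (p * a)) * (\<Sum>q\<in>C. chi (q * b)))"
    by (intro sum.mono_neutral_cong_left)
      (auto simp: orthogonal_pairs_def sum_chi_subspace [OF C] power2_eq_square split: if_splits)
  also have "\<dots> = (\<Sum>(a, b)\<in>conic s. \<Sum>(p, q)\<in>C \<times> C. chi (p * a + q * b))"
    by (simp add: sum_product sum.cartesian_product chi_add)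
  also have "\<dots> = (\<Sum>(p, q)\<in>C \<times> C. \<Sum>(a, b)\<in>conic s. chi (p * a + q * b))"
    unfolding split_beta by (rule sum.swap)
  also have "\<dots> = (\<Sum>(a, b)\<in>conic s. chi (0 * a + 0 * b))
      + (\<Sum>(p, q)\<in>C \<times> C - {(0, 0)}. \<Sum>(a, b)\<in>conic s. chi (p * a + q * b))"
    using F2.subspace_0 [OF C] by (subst sum.remove [of _ "(0, 0)"]) auto
  also have "(\<Sum>(a, b)\<in>conic s. chi (0 * a + 0 * b)) = 2 ^ n - chi 1"
    using card_conic [OF assms(2)] by simp
  also have "(\<Sum>(p, q)\<in>C \<times> C - {(0, 0)}. \<Sum>(a, b)\<in>conic s. chi (p * a + q * b))
      = (\<Sum>(p, q)\<in>C \<times> C - {(0, 0)}. chi 1 * kloosterman (qf p q * s\<^sup>2))"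
  proof (intro sum.cong refl)
    fix pq assume pq: "pq \<in> C \<times> C - {(0, 0)}"
    obtain p q where "pq = (p, q)" by fastforce
    moreover from this have "qf p q \<noteq> 0" using pq aniso [of p q] by blast
    ultimately show "(case pq of (p, q) \<Rightarrow> \<Sum>(a, b)\<in>conic s. chi (p * a + q * b))
        = (case pq of (p, q) \<Rightarrow> chi 1 * kloosterman (qf p q * s\<^sup>2))"
      by (simp add: sum_chi_conic [OF assms(2)])
  qed
  finally show ?thesis by (simp add: sum_distrib_left split_beta)
qed

section \<open>Zero sums from pairs orthogonal to a subspace\<close>

abbreviation plane :: "'a \<Rightarrow> 'a \<Rightarrow> 'a set"
  where "plane a b \<equiv> {0, a, b, a + b}"

lemma subspace_plane: "F2.subspace (plane a b)"
  unfolding subspace_iff by (auto simp: algebra_simps)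

context
  fixes a b :: 'a
  assumes ab: "a \<noteq> 0" "b \<noteq> 0" "a \<noteq> b"
begin

lemma dim_plane: "F2.dim (plane a b) = 2"
  using subspace_plane by (rule dim_eqI) (use ab in \<open>simp add: card_insert_if\<close>)

lemma slope_plane: "slope (plane a b) = a * b * (a + b)"
proof -
  have "plane a b - {0} = {a, b, a + b}" using ab by auto
  then show ?thesis using ab by (simp add: slope_def mult.assoc)
qed

lemma inv_sum_plane: "inv_sum (plane a b) = qf a b / slope (plane a b)"
proof -
  have "inv_sum (plane a b) = inverse a + inverse b + inverse (a + b)"
    using ab by (simp add: inv_sum_def add.assoc)
  also have "\<dots> = (b * (a + b) + a * (a + b) + a * b) / (a * b * (a + b))"
    using ab by (simp add: divide_simps) (simp add: algebra_simps)
  also have "b * (a + b) + a * (a + b) + a * b = qf a b"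
    by (simp add: qf_def algebra_simps power2_eq_square)
  finally show ?thesis by (simp only: slope_plane)
qed

text \<open>
  The argument has the form \<open>y\<^sup>2 + y\<close>, because \<open>L(x)\<close> is
  \<open>m\<^sup>2 + d * m\<close> with \<open>m = x * (x + a)\<close> and \<open>d = b * (a +
  b)\<close>, and \<open>a / D = 1 / d\<close>.
\<close>

lemma chi_vanish_plane: "chi (a\<^sup>2 * vanish (plane a b) x / (slope (plane a b))\<^sup>2) = 1"
proof -
  define y where "y = x * (x + a) / (b * (a + b))"
  have "a\<^sup>2 * vanish (plane a b) x / (slope (plane a b))\<^sup>2
      = x * (x + a) * ((x + b) * (x + (a + b))) / (b * (a + b))\<^sup>2"
    using ab by (simp add: vanish_def slope_plane power_mult_distrib mult.assoc)
  also have "(x + b) * (x + (a + b)) = x * (x + a) + b * (a + b)"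
    by (simp add: algebra_simps)
  also have "x * (x + a) * (x * (x + a) + b * (a + b)) / (b * (a + b))\<^sup>2 = y\<^sup>2 + y"
  proof -
    have "m * (m + d) / d\<^sup>2 = (m / d)\<^sup>2 + m / d" if "d \<noteq> 0" for m d :: 'a
      using that by (simp add: field_simps power2_eq_square)
    then show ?thesis using ab by (simp add: y_def)
  qed
  finally show ?thesis using chi_cases [of y] by (auto simp: chi_add)
qed

end

text \<open>
  The image of \<open>L\<close> is contained in the set of all such \<open>(D * c)\<^sup>2\<close>
  by the previous lemma, applied to \<open>a\<close> and to \<open>b\<close>; both sets have
  \<open>2 ^ n / 4\<close> elements, so they are equal.
\<close>

lemma range_vanish_plane:
  assumes ab: "a \<noteq> 0" "b \<noteq> 0" "a \<noteq> b" and "chi (a * c) = 1" "chi (b * c) = 1"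
  shows "(slope (plane a b) * c)\<^sup>2 \<in> range (vanish (plane a b))"
proof -
  let ?A = "plane a b" and ?T = "{c. chi (a * c) = 1 \<and> chi (b * c) = 1}"
  let ?g = "\<lambda>c. (slope ?A * c)\<^sup>2"
  have A: "F2.subspace ?A" by (rule subspace_plane)
  \<comment> \<open>The elements orthogonal to \<open>a\<close> and \<open>b\<close> are counted by summing \<open>chi (p * c)\<close> over both variables in two ways.\<close>
  have "(\<Sum>c\<in>UNIV. \<Sum>p\<in>?A. chi (p * c)) = (\<Sum>c\<in>UNIV. if c \<in> ?T then 4 else 0)"
    using card_subspace [OF A] dim_plane [OF ab]
    by (intro sum.cong refl, subst sum_chi_subspace [OF A]) (auto simp: distrib_right chi_add)
  moreover have "(\<Sum>c\<in>UNIV. \<Sum>p\<in>?A. chi (p * c)) = (\<Sum>p\<in>?A. \<Sum>c\<in>UNIV. chi (c * p))"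
    by (subst sum.swap) (simp add: mult.commute)
  moreover have "\<dots> = (\<Sum>p\<in>?A. if p = 0 then 2 ^ n else 0)" by (simp only: sum_chi)
  moreover have "\<dots> = 2 ^ n" by simp
  ultimately have "real (4 * card ?T) = real (2 ^ n)" by (simp flip: sum.inter_filter)
  then have "4 * card ?T = 2 ^ n" by (simp only: of_nat_eq_iff)
  moreover have "card (range (vanish ?A)) * 4 = 2 ^ n"
  proof -
    have "n = 2 + F2.dim (range (vanish ?A))"
      using dim_range_vanish [OF A] dim_plane [OF ab] by simp
    then have "(2::nat) ^ n = 2 ^ (2 + F2.dim (range (vanish ?A)))" by (rule arg_cong)
    then show ?thesis
      using card_subspace [OF subspace_image_vanish [OF A F2.subspace_UNIV]] by simp
  qed
  moreover have "inj ?g" by (auto simp: inj_def)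
  then have "card (?g ` ?T) = card ?T" by (intro card_image) (auto simp: inj_on_def)
  moreover have "range (vanish ?A) \<subseteq> ?g ` ?T"
  proof
    fix w assume "w \<in> range (vanish ?A)"
    then obtain x where x: "w = vanish ?A x" by blast
    obtain r where r: "r\<^sup>2 = w" using square_surj by blast
    have sq: "(e * (r / slope ?A))\<^sup>2 = e\<^sup>2 * vanish ?A x / (slope ?A)\<^sup>2" for e
      by (simp add: power_mult_distrib power_divide r x)
    have "plane b a = ?A" by (auto simp: add.commute)
    then have "chi (e * (r / slope ?A)) = 1" if "e = a \<or> e = b" for e
      using that chi_vanish_plane [OF ab, of x] chi_vanish_plane [of b a x] ab
      by (metis chi_square sq)
    then have "r / slope ?A \<in> ?T" by auto
    moreover have "w = ?g (r / slope ?A)" using r by simp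
    ultimately show "w \<in> ?g ` ?T" by blast
  qed
  ultimately have "range (vanish ?A) = ?g ` ?T" by (intro card_subset_eq) auto
  then show ?thesis using assms by auto
qed

text \<open>
  Compose the plane \<open>A\<close> spanned by \<open>a\<close> and \<open>b\<close> with \<open>B
  = {(D * c)\<^sup>2 | c \<in> C}\<close>. As squaring is additive, \<open>S(B) = S(C)\<^sup>2 /
  D\<^sup>2\<close>, and \<open>S(A) = qf a b / D\<close>. So the sum \<open>S(A) + D * S(B)\<close>
  vanishes exactly on the conic.
\<close>

lemma zero_sum_dim_from_orthogonal_pair:
  assumes C: "F2.subspace C" and pair: "(a, b) \<in> orthogonal_pairs C (inv_sum C)"
    and ab: "a \<noteq> 0" "b \<noteq> 0" "a \<noteq> b"
  shows "zero_sum_dim (2 + F2.dim C)"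
proof -
  let ?A = "plane a b" and ?g = "\<lambda>c. (slope (plane a b) * c)\<^sup>2"
  have A: "F2.subspace ?A" by (rule subspace_plane)
  have inj: "inj_on ?g C" by (auto simp: inj_on_def)
  have add: "?g (x + y) = ?g x + ?g y" for x y by (simp add: distrib_left square_add)
  have B: "F2.subspace (?g ` C)"
    using F2.subspace_0 [OF C] F2.subspace_add [OF C]
    unfolding subspace_iff [of "?g ` C"] by (auto simp flip: add simp: image_iff)
  have dimB: "F2.dim (?g ` C) = F2.dim C"
    by (rule dim_eqI [OF B]) (simp add: card_image [OF inj] card_subspace [OF C])
  have range: "?g ` C \<subseteq> range (vanish ?A)"
  proof -
    have "chi (a * c) = 1" "chi (b * c) = 1" if "c \<in> C" for c
      using pair that by (auto simp: orthogonal_pairs_def mult.commute)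
    then show ?thesis using range_vanish_plane [OF ab] by blast
  qed
  have "(\<Sum>c\<in>I. f c)\<^sup>2 = (\<Sum>c\<in>I. (f c)\<^sup>2)" if "finite I" for f :: "'a \<Rightarrow> 'a" and I
    using that by induction (simp_all add: square_add)
  then have "inv_sum (?g ` C) = (inv_sum C)\<^sup>2 / (slope ?A)\<^sup>2"
    unfolding inv_sum_def sum.reindex [OF inj]
    by (simp add: sum_distrib_right power_mult_distrib divide_inverse power_inverse mult.commute)
  moreover have "qf a b = (inv_sum C)\<^sup>2"
    using pair by (simp add: orthogonal_pairs_def conic_def)
  ultimately have "inv_sum ?A + slope ?A * inv_sum (?g ` C) = 0"
    by (simp add: inv_sum_plane [OF ab] power2_eq_square)
  then show ?thesis
    using compose_subspaces [OF A B range] subspace_vimage_vanish [OF A B] dim_plane [OF ab] dimB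
    unfolding zero_sum_dim_def by metis
qed

text \<open>
  At most three points of the conic have coordinates that are dependent over the two-element field:
  \<open>(0, S(C))\<close>, \<open>(S(C), 0)\<close> and \<open>(S(C), S(C))\<close>. So the bound
  only has to leave room for a fourth orthogonal pair.
\<close>

lemma zero_sum_dim_by_counting:
  assumes C: "F2.subspace C" and nz: "inv_sum C \<noteq> 0"
    and aniso: "\<And>p q. p \<in> C \<Longrightarrow> q \<in> C \<Longrightarrow> qf p q = 0 \<Longrightarrow> p = 0 \<and> q = 0"
    and bound: "(\<Sum>(p, q)\<in>C \<times> C - {(0, 0)}. \<bar>kloosterman (qf p q * (inv_sum C)\<^sup>2)\<bar>)
      < 2 ^ n - 1 - 3 * (real (card C))\<^sup>2"
  shows "zero_sum_dim (2 + F2.dim C)"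
proof (rule ccontr)
  let ?s = "inv_sum C" and ?P = "C \<times> C - {(0, 0)}"
  assume "\<not> zero_sum_dim (2 + F2.dim C)"
  then have dep: "a = 0 \<or> b = 0 \<or> a = b" if "(a, b) \<in> orthogonal_pairs C ?s" for a b
    using zero_sum_dim_from_orthogonal_pair [OF C that] by blast
  have "(a, b) \<in> {(0, ?s), (?s, 0), (?s, ?s)}" if ab: "(a, b) \<in> orthogonal_pairs C ?s" for a b
  proof -
    have "qf a b = ?s\<^sup>2" using ab by (simp add: orthogonal_pairs_def conic_def)
    then show ?thesis using dep [OF ab]
      by (auto simp: qf_def simp flip: power2_eq_square)
  qed
  then have "orthogonal_pairs C ?s \<subseteq> {(0, ?s), (?s, 0), (?s, ?s)}" by auto
  then have "card (orthogonal_pairs C ?s) \<le> card {(0, ?s), (?s, 0), (?s, ?s)}"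
    by (intro card_mono) auto
  also have "\<dots> \<le> 3" by (simp add: card_insert_if)
  finally have "real (card (orthogonal_pairs C ?s)) * (real (card C))\<^sup>2 \<le> 3 * (real (card C))\<^sup>2"
    by (intro mult_right_mono) auto
  then have "2 ^ n - chi 1 + chi 1 * (\<Sum>(p, q)\<in>?P. kloosterman (qf p q * ?s\<^sup>2)) \<le> 3 * (real (card C))\<^sup>2"
    by (simp only: card_orthogonal_pairs [OF C nz aniso])
  moreover have "\<bar>\<Sum>(p, q)\<in>?P. kloosterman (qf p q * ?s\<^sup>2)\<bar>
      \<le> (\<Sum>(p, q)\<in>?P. \<bar>kloosterman (qf p q * ?s\<^sup>2)\<bar>)"
    unfolding split_beta by (rule sum_abs)
  moreover have False if "e = 1 \<or> e = - 1" "Q - e + e * X \<le> B" "\<bar>X\<bar> \<le> Y" "Y < Q - 1 - B"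
    for e Q X Y B :: real using that by auto
  ultimately show False using bound chi_cases [of 1] by blast
qed

section \<open>Dimension three\<close>

lemma inv_sum_F2: "inv_sum {0, 1} = 1"
  by (simp add: inv_sum_def)

text \<open>
  Substituting \<open>y = s * x\<close> in the square of \<open>K(1)\<close> gives \<open>K((1 + s)
  * (1 + 1 / s))\<close> for every \<open>s \<noteq> 0, 1\<close>. The argument takes each value at
  most twice.
\<close>

lemma kloosterman_one_squared:
  "(kloosterman 1)\<^sup>2 \<le> 2 ^ n + sqrt 2 * 2 ^ n * sqrt (2 ^ n)"
proof -
  let ?U = "UNIV - {0 :: 'a}"
  \<comment> \<open>The substitution \<open>y = s * x\<close>.\<close>
  have reparam: "(\<Sum>y\<in>?U. chi (x + 1 / x + (y + 1 / y))) = (\<Sum>s\<in>?U. chi ((1 + s) * x + (1 + 1 / s) / x))"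
    if "x \<in> ?U" for x
    by (rule sum.reindex_bij_witness [of _ "\<lambda>s. s * x" "\<lambda>y. y / x"])
      (use that in \<open>auto simp: algebra_simps add_divide_distrib\<close>)
  have "(kloosterman 1)\<^sup>2 = (\<Sum>x\<in>?U. \<Sum>y\<in>?U. chi (x + 1 / x + (y + 1 / y)))"
    by (simp add: kloosterman_def power2_eq_square sum_product chi_add)
  also have "\<dots> = (\<Sum>s\<in>?U. \<Sum>x\<in>?U. chi ((1 + s) * x + (1 + 1 / s) / x))"
    using reparam by (subst sum.swap) simp
  also have "\<dots> = real (card ?U) + (\<Sum>s\<in>?U - {1}. \<Sum>x\<in>?U. chi ((1 + s) * x + (1 + 1 / s) / x))"
    by (subst sum.remove [of _ 1]) auto
  also have "(\<Sum>s\<in>?U - {1}. \<Sum>x\<in>?U. chi ((1 + s) * x + (1 + 1 / s) / x))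
      = (\<Sum>s\<in>?U - {1}. kloosterman ((1 + s) * (1 + 1 / s)))"
    by (intro sum.cong refl sum_chi_kloosterman) auto
  also have "\<dots> \<le> (\<Sum>s\<in>?U - {1}. \<bar>kloosterman ((1 + s) * (1 + 1 / s))\<bar>)"
    by (intro sum_mono) auto
  also have "\<dots> \<le> sqrt (real 2) * 2 ^ n * sqrt (2 ^ n)"
  proof (rule sum_abs_kloosterman_le)
    fix v :: 'a
    have "s\<^sup>2 + v * s + 1 = 0" if "s \<noteq> 0" "(1 + s) * (1 + 1 / s) = v" for s
    proof -
      have "v * s = s\<^sup>2 + 1" using that by (auto simp: field_simps power2_eq_square)
      then show ?thesis by (simp add: add.assoc)
    qed
    then have "{s \<in> ?U - {1}. (1 + s) * (1 + 1 / s) = v} \<subseteq> {s. poly [:1, v, 1:] s = 0}"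
      by (auto simp: power2_eq_square algebra_simps)
    then have "card {s \<in> ?U - {1}. (1 + s) * (1 + 1 / s) = v} \<le> card {s. poly [:1, v, 1:] s = 0}"
      by (intro card_mono) auto
    also have "\<dots> \<le> 2" using card_poly_roots_bound [of "[:1, v, 1:]"] by simp
    finally show "card {s \<in> ?U - {1}. (1 + s) * (1 + 1 / s) = v} \<le> 2" .
  qed
  finally show ?thesis by (simp add: card_field card_Diff_subset)
qed

lemma abs_kloosterman_one:
  assumes "n \<ge> 8"
  shows "3 * \<bar>kloosterman 1\<bar> < 2 ^ n - 13"
proof (rule ccontr)
  define t where "t = sqrt (2 ^ n :: real)"
  have t2: "2 ^ n = t\<^sup>2" by (simp add: t_def)
  have "(2::real) ^ 8 \<le> 2 ^ n" using assms by (intro power_increasing) auto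
  then have "sqrt (16\<^sup>2) \<le> t" unfolding t_def by (intro real_sqrt_le_mono) simp
  then have t: "t \<ge> 16" by simp
  have s2: "sqrt 2 \<le> 3 / 2" by (rule real_le_lsqrt) (auto simp: power2_eq_square)
  \<comment> \<open>With \<open>sqrt 2 \<le> 3 / 2\<close> the estimate for \<open>K(1)\<close> would give
    \<open>(t\<^sup>2 - 13)\<^sup>2 \<le> 9 * (t\<^sup>2 + 3 / 2 * t\<^sup>3)\<close>, which just fails for \<open>t \<ge> 16\<close>.\<close>
  assume "\<not> ?thesis"
  then have "(t\<^sup>2 - 13)\<^sup>2 \<le> (3 * \<bar>kloosterman 1\<bar>)\<^sup>2"
    using t by (intro power_mono) (auto simp: t2 power2_eq_square intro: order_trans [OF _ mult_mono [of 16 t 16 t]])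
  also have "\<dots> \<le> 9 * (t\<^sup>2 + sqrt 2 * t\<^sup>2 * t)"
    using kloosterman_one_squared by (simp add: power_mult_distrib t2 [symmetric] flip: t_def)
  also have "\<dots> \<le> 9 * (t\<^sup>2 + 3 / 2 * t\<^sup>2 * t)"
    using s2 t by (intro mult_left_mono add_left_mono mult_right_mono) auto
  finally have "t * t * (t * t - 27 / 2 * t - 35) + 169 \<le> 0"
    by (simp add: power2_eq_square algebra_simps)
  moreover have "t * t * (t * t - 27 / 2 * t - 35) \<ge> 0"
  proof -
    have "t * (t - 27 / 2) \<ge> 16 * (5 / 2)" using t by (intro mult_mono) auto
    then show ?thesis using t by (intro mult_nonneg_nonneg) (auto simp: algebra_simps)
  qed
  ultimately show False by simp
qed

text \<open>
  Take \<open>C = {0, 1}\<close>. The three nonzero pairs from \<open>C\<close> all contribute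
  \<open>K(1)\<close>.
\<close>

lemma zero_sum_dim_3:
  assumes "n \<ge> 8"
  shows "zero_sum_dim 3"
proof -
  let ?P = "{0, 1 :: 'a} \<times> {0, 1 :: 'a} - {(0, 0)}"
  have P: "?P = {(0, 1), (1, 0), (1, 1)}" by auto
  have "(\<Sum>(p, q)\<in>?P. \<bar>kloosterman (qf p q * (inv_sum {0, 1})\<^sup>2)\<bar>) = 3 * \<bar>kloosterman 1\<bar>"
    unfolding P by (simp add: inv_sum_F2 qf_def)
  moreover have "card {0, 1 :: 'a} = 2" by simp
  ultimately have bound: "(\<Sum>(p, q)\<in>?P. \<bar>kloosterman (qf p q * (inv_sum {0, 1})\<^sup>2)\<bar>)
      < 2 ^ n - 1 - 3 * (real (card {0, 1 :: 'a}))\<^sup>2"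
    using abs_kloosterman_one [OF assms] by (simp only:) simp
  have aniso: "p = 0 \<and> q = 0" if "p \<in> {0, 1}" "q \<in> {0, 1}" "qf p q = 0" for p q :: 'a
    using that by (auto simp: qf_def)
  have "inv_sum {0, 1} \<noteq> 0" by (simp add: inv_sum_F2)
  from zero_sum_dim_by_counting [OF subspace_F2 this aniso bound]
  have "zero_sum_dim (2 + F2.dim {0, 1})" .
  then show ?thesis by (simp add: dim_F2)
qed

section \<open>Averaging over one-element extensions\<close>

text \<open>
  A nontrivial zero would make 1 of the form \<open>y\<^sup>2 + y\<close>, but the trace of 1 is
  \<open>n\<close>, which is odd.
\<close>

lemma qf_anisotropic:
  assumes "odd n" "qf p q = 0"
  shows "p = 0 \<and> q = 0"
proof (cases "q = 0")
  case True
  then show ?thesis using assms by (simp add: qf_def)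
next
  case False
  have "(p / q)\<^sup>2 + p / q + 1 = qf p q / q\<^sup>2"
    using False by (simp add: qf_def field_simps power2_eq_square)
  then have "(p / q)\<^sup>2 + p / q = 1" using assms by simp
  then have "tr 1 = 0" by (metis tr_eq_0_iff)
  then show ?thesis using assms by (simp add: tr_one of_nat_parity)
qed

lemma sum_extend_subspace:
  fixes g :: "'a \<Rightarrow> 'b::comm_monoid_add"
  assumes "F2.subspace A" "w \<notin> A"
  shows "(\<Sum>x\<in>A \<union> (+) w ` A. g x) = (\<Sum>(a, e)\<in>A \<times> {0, 1}. g (a + e * w))"
proof -
  have "(\<Sum>x\<in>A \<union> (+) w ` A. g x) = (\<Sum>a\<in>A. g a) + (\<Sum>a\<in>A. g (a + w))"
    using subspace_extend_disjoint [OF assms]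
    by (simp add: sum.union_disjoint sum.reindex add.commute)
  also have "\<dots> = (\<Sum>a\<in>A. \<Sum>e\<in>{0, 1}. g (a + e * w))" by (simp add: sum.distrib)
  also have "\<dots> = (\<Sum>(a, e)\<in>A \<times> {0, 1}. g (a + e * w))" by (rule sum.cartesian_product)
  finally show ?thesis .
qed

lemma inv_sum_extend:
  assumes "F2.subspace A" "w \<notin> A"
  shows "inv_sum (A \<union> (+) w ` A) = inv_sum A + slope A / vanish A w"
  using subspace_extend_disjoint [OF assms] sum_inverse_coset [OF assms]
  by (simp add: inv_sum_def sum.union_disjoint sum.reindex)

text \<open>
  Multiplied by \<open>L(z)\<^sup>2\<close>, the equation becomes polynomial in \<open>z\<close>, of
  degree at most \<open>2 * card A + 2\<close>. The polynomial is not zero: at \<open>c \<in>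
  A\<close> it takes the value \<open>qf (p + d * c) (q + e * c) * D\<^sup>2\<close>, and by
  anisotropy this cannot vanish for both \<open>c = 0\<close> and some other \<open>c \<in>
  A\<close>.
\<close>

lemma card_fibre_le:
  assumes n: "odd n" and A: "F2.subspace A" and dim: "F2.dim A \<ge> 1"
    and pq: "p \<in> A" "q \<in> A" and nz: "((p, d), (q, e)) \<noteq> ((0, 0), (0, 0))"
  shows "card {z. z \<notin> A \<and> qf (p + d * z) (q + e * z) * (inv_sum A + slope A / vanish A z)\<^sup>2 = v}
    \<le> 2 * card A + 2"
proof -
  define L where "L = (\<Prod>a\<in>A. [:a, 1:])"
  have L: "poly L z = vanish A z" for z
    by (simp add: L_def vanish_def poly_prod add.commute)
  have degL: "degree L = card A"
    unfolding L_def by (subst degree_prod_eq_sum_degree) auto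
  define P where "P = [:p, d:]\<^sup>2 + [:p, d:] * [:q, e:] + [:q, e:]\<^sup>2"
  have P: "poly P z = qf (p + d * z) (q + e * z)" for z
    by (simp add: P_def qf_def algebra_simps power2_eq_square)
  have degP: "degree P \<le> 2"
  proof -
    have l: "degree [:x, y:] \<le> 1" for x y :: 'a by simp
    have "degree ([:x, y:] * [:x', y':]) \<le> 2" for x y x' y' :: 'a
      using degree_mult_le [of "[:x, y:]" "[:x', y':]"] l [of x y] l [of x' y'] by linarith
    then show ?thesis unfolding P_def power2_eq_square by (intro degree_add_le)
  qed
  define G where "G = P * ([:inv_sum A:] * L + [:slope A:])\<^sup>2 - [:v:] * L\<^sup>2"
  have G: "poly G z = qf (p + d * z) (q + e * z) * (inv_sum A * vanish A z + slope A)\<^sup>2 - v * (vanish A z)\<^sup>2" for z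
    by (simp add: G_def P L)
  have "G \<noteq> 0"
  proof
    assume "G = 0"
    then have "qf (p + d * c) (q + e * c) * (slope A)\<^sup>2 = 0" if "c \<in> A" for c
    proof -
      have "vanish A c = 0" using that vanish_eq_0_iff [OF A] by blast
      then show ?thesis using G [of c] \<open>G = 0\<close> by simp
    qed
    then have *: "p + d * c = 0 \<and> q + e * c = 0" if "c \<in> A" for c
      using qf_anisotropic [OF n] that by (metis slope_nonzero mult_eq_0_iff zero_eq_power2)
    have "card A \<noteq> 1" using card_subspace [OF A] dim by simp
    then obtain c where c: "c \<in> A" "c \<noteq> 0"
      using F2.subspace_0 [OF A] by (metis is_singletonI' is_singleton_altdef empty_iff)
    have "p = 0" "q = 0" using * [of 0] F2.subspace_0 [OF A] by auto
    then show False using * [OF c(1)] c(2) nz by simp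
  qed
  have "degree G \<le> 2 * card A + 2"
  proof -
    have M: "degree ([:inv_sum A:] * L + [:slope A:]) \<le> card A"
      using degree_mult_le [of "[:inv_sum A:]" L] degL by (intro degree_add_le) auto
    have "degree (([:inv_sum A:] * L + [:slope A:])\<^sup>2) \<le> 2 * card A"
      using degree_power_le [of "[:inv_sum A:] * L + [:slope A:]" 2] M by linarith
    then have 1: "degree (P * ([:inv_sum A:] * L + [:slope A:])\<^sup>2) \<le> 2 * card A + 2"
      using degree_mult_le [of P "([:inv_sum A:] * L + [:slope A:])\<^sup>2"] degP by linarith
    have "degree ([:v:] * L\<^sup>2) \<le> 2 * card A + 2"
      using degree_mult_le [of "[:v:]" "L\<^sup>2"] degree_power_le [of L 2] degL by simp
    then show ?thesis unfolding G_def using 1 by (intro degree_diff_le)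
  qed
  then have "card {z. poly G z = 0} \<le> 2 * card A + 2"
    using card_poly_roots_bound [OF \<open>G \<noteq> 0\<close>] by linarith
  moreover have "poly G z = 0"
    if "z \<notin> A" "qf (p + d * z) (q + e * z) * (inv_sum A + slope A / vanish A z)\<^sup>2 = v" for z
  proof -
    have "vanish A z \<noteq> 0" using that vanish_eq_0_iff [OF A] by simp
    then have "inv_sum A * vanish A z + slope A = (inv_sum A + slope A / vanish A z) * vanish A z"
      by (simp add: field_simps)
    then show ?thesis using that(2) [symmetric] by (simp add: G power_mult_distrib)
  qed
  then have "card {z. z \<notin> A \<and> qf (p + d * z) (q + e * z) * (inv_sum A + slope A / vanish A z)\<^sup>2 = v}
      \<le> card {z. poly G z = 0}" by (intro card_mono) auto
  ultimately show ?thesis by linarith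
qed

text \<open>
  Otherwise the counting criterion fails for each extension \<open>C\<close> of \<open>A\<close> by
  an element \<open>z\<close> with \<open>S(C) \<noteq> 0\<close>, so that the Kloosterman sums for
  \<open>C\<close> are large. Summing over \<open>z\<close> contradicts the bound for the average.
  Elements of \<open>C\<close> are parametrised as \<open>p + d * z\<close> with \<open>p \<in>
  A\<close> and \<open>d \<in> {0, 1}\<close>, so that each pair of parameters gives a fixed
  rational function of \<open>z\<close>. At most \<open>2 * card A\<close> elements \<open>z\<close>
  are excluded: those in \<open>A\<close>, and those with \<open>L(z) = D / S(A)\<close>, for which
  \<open>S(C) = 0\<close>.
\<close>

lemma zero_sum_dim_by_averaging:
  assumes n: "odd n" and A: "F2.subspace A" and dim: "F2.dim A \<ge> 1" and nz: "inv_sum A \<noteq> 0"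
    and pos: "0 \<le> 2 ^ n - 1 - 3 * (2 * real (card A))\<^sup>2"
    and bound: "(2 * real (card A))\<^sup>2 * (sqrt (2 * card A + 2) * 2 ^ n * sqrt (2 ^ n))
      < (2 ^ n - 2 * real (card A)) * (2 ^ n - 1 - 3 * (2 * real (card A))\<^sup>2)"
  shows "zero_sum_dim (3 + F2.dim A)"
proof (rule ccontr)
  assume contr: "\<not> zero_sum_dim (3 + F2.dim A)"
  let ?J = "(A \<times> {0, 1 :: 'a}) \<times> (A \<times> {0, 1 :: 'a}) - {((0, 0), (0, 0))}"
  define S where "S z = inv_sum A + slope A / vanish A z" for z
  define f where "f = (\<lambda>((p, d), (q, e)) z. qf (p + d * z) (q + e * z) * (S z)\<^sup>2)"
  define Z where "Z = {z. z \<notin> A \<and> S z \<noteq> 0}"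
  let ?B = "2 ^ n - 1 - 3 * (2 * real (card A))\<^sup>2"
  have lower: "?B \<le> (\<Sum>j\<in>?J. \<bar>kloosterman (f j z)\<bar>)" if "z \<in> Z" for z
  proof (rule ccontr)
    assume small: "\<not> ?thesis"
    have z: "z \<notin> A" "S z \<noteq> 0" using that by (auto simp: Z_def)
    let ?C = "A \<union> (+) z ` A"
    have inv: "inv_sum ?C = S z" by (simp add: inv_sum_extend [OF A z(1)] S_def)
    define g where "g p q = (if (p, q) = (0, 0) then 0 else \<bar>kloosterman (qf p q * (S z)\<^sup>2)\<bar>)" for p q
    have "(\<Sum>(p, q)\<in>?C \<times> ?C - {(0, 0)}. \<bar>kloosterman (qf p q * (inv_sum ?C)\<^sup>2)\<bar>)
        = (\<Sum>(p, q)\<in>?C \<times> ?C. g p q)"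
      by (intro sum.mono_neutral_cong_left) (auto simp: g_def inv split: if_splits)
    also have "\<dots> = (\<Sum>p\<in>?C. \<Sum>q\<in>?C. g p q)" by (simp add: sum.cartesian_product)
    also have "\<dots> = (\<Sum>(p, d)\<in>A \<times> {0, 1}. \<Sum>(q, e)\<in>A \<times> {0, 1}. g (p + d * z) (q + e * z))"
      by (simp add: sum_extend_subspace [OF A z(1)] split_beta)
    also have "\<dots> = (\<Sum>j\<in>(A \<times> {0, 1 :: 'a}) \<times> (A \<times> {0, 1 :: 'a}).
        case j of ((p, d), (q, e)) \<Rightarrow> g (p + d * z) (q + e * z))"
      by (simp add: sum.cartesian_product split_beta)
    also have "\<dots> = (\<Sum>j\<in>?J. \<bar>kloosterman (f j z)\<bar>)"
    proof (intro sum.mono_neutral_cong_right)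
      fix j assume j: "j \<in> ?J"
      obtain p d q e where pdqe: "j = ((p, d), (q, e))" by (metis surj_pair)
      have indep: "x = 0 \<and> y = 0" if "x \<in> A" "y \<in> {0, 1}" "x + y * z = 0" for x y
        using that z(1) by auto
      have "\<not> (p + d * z = 0 \<and> q + e * z = 0)" using j indep [of p d] indep [of q e]
        unfolding pdqe by blast
      then show "(case j of ((p, d), (q, e)) \<Rightarrow> g (p + d * z) (q + e * z)) = \<bar>kloosterman (f j z)\<bar>"
        unfolding pdqe f_def g_def by (auto simp del: add_eq_0)
    qed (auto simp: g_def)
    finally have "(\<Sum>(p, q)\<in>?C \<times> ?C - {(0, 0)}. \<bar>kloosterman (qf p q * (inv_sum ?C)\<^sup>2)\<bar>)
        < 2 ^ n - 1 - 3 * (real (card ?C))\<^sup>2"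
      using small by (simp add: card_extend [OF A z(1)])
    moreover have "inv_sum ?C \<noteq> 0" using z(2) by (simp only: inv not_False_eq_True)
    ultimately have "zero_sum_dim (2 + F2.dim ?C)"
      using zero_sum_dim_by_counting [OF subspace_extend [OF A]] qf_anisotropic [OF n] by blast
    then show False using contr by (simp add: dim_extend [OF A z(1)] numeral_3_eq_3)
  qed
  have "real (card Z) * ?B \<le> (\<Sum>z\<in>Z. \<Sum>j\<in>?J. \<bar>kloosterman (f j z)\<bar>)"
    using sum_mono [of Z "\<lambda>_. ?B", OF lower] by simp
  also have "\<dots> = (\<Sum>j\<in>?J. \<Sum>z\<in>Z. \<bar>kloosterman (f j z)\<bar>)" by (rule sum.swap)
  also have "\<dots> \<le> (\<Sum>j\<in>?J. sqrt (real (2 * card A + 2)) * 2 ^ n * sqrt (2 ^ n))"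
  proof (intro sum_mono sum_abs_kloosterman_le)
    fix j v assume j: "j \<in> ?J"
    obtain p d q e where pdqe: "j = ((p, d), (q, e))" by (metis surj_pair)
    have "card {z \<in> Z. f j z = v}
        \<le> card {z. z \<notin> A \<and> qf (p + d * z) (q + e * z) * (inv_sum A + slope A / vanish A z)\<^sup>2 = v}"
      unfolding pdqe by (intro card_mono) (auto simp: Z_def f_def S_def)
    also have "\<dots> \<le> 2 * card A + 2"
      using j unfolding pdqe by (intro card_fibre_le [OF n A dim]) auto
    finally show "card {z \<in> Z. f j z = v} \<le> 2 * card A + 2" .
  qed
  also have "\<dots> \<le> (2 * real (card A))\<^sup>2 * (sqrt (2 * card A + 2) * 2 ^ n * sqrt (2 ^ n))"
  proof -
    have "card ?J \<le> card ((A \<times> {0, 1 :: 'a}) \<times> (A \<times> {0, 1 :: 'a}))" by (intro card_mono) auto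
    also have "\<dots> = (2 * card A)\<^sup>2" by (simp add: card_cartesian_product power2_eq_square algebra_simps)
    finally have "card ?J \<le> (2 * card A)\<^sup>2" .
    then have "real (card ?J) \<le> (2 * real (card A))\<^sup>2"
      by (metis of_nat_le_iff of_nat_mult of_nat_numeral of_nat_power)
    then show ?thesis by (simp add: mult_right_mono)
  qed
  also have "\<dots> < (2 ^ n - 2 * real (card A)) * ?B" by (rule bound)
  also have "\<dots> \<le> real (card Z) * ?B"
  proof (rule mult_right_mono)
    have "UNIV - Z \<subseteq> A \<union> {z. vanish A z = slope A / inv_sum A}"
    proof
      fix z assume "z \<in> UNIV - Z"
      then have "z \<in> A \<or> S z = 0" by (simp add: Z_def)
      moreover have "vanish A z = slope A / inv_sum A" if "S z = 0" "z \<notin> A"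
        using that nz vanish_eq_0_iff [OF A] by (auto simp: S_def field_simps)
      ultimately show "z \<in> A \<union> {z. vanish A z = slope A / inv_sum A}" by auto
    qed
    then have "card (UNIV - Z) \<le> card (A \<union> {z. vanish A z = slope A / inv_sum A})"
      by (intro card_mono) auto
    also have "\<dots> \<le> card A + card {z. vanish A z = slope A / inv_sum A}" by (rule card_Un_le)
    also have "card {z. vanish A z = slope A / inv_sum A} \<le> card A"
    proof (cases "\<exists>x. vanish A x = slope A / inv_sum A")
      case True
      then obtain x where "slope A / inv_sum A = vanish A x" by metis
      then show ?thesis by (simp add: vanish_fibre [OF A] card_image)
    qed auto
    finally have "2 ^ n \<le> card Z + 2 * card A"
      by (simp add: card_Diff_subset card_field)
    then have "real (2 ^ n) \<le> real (card Z + 2 * card A)" by (simp only: of_nat_le_iff)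
    then show "2 ^ n - 2 * real (card A) \<le> real (card Z)" by simp
  qed (rule pos)
  finally show False by simp
qed

end

section \<open>Explicit computations with polynomials over the two-element field\<close>

text \<open>
  A polynomial over the two-element field is the list of its coefficients, lowest degree first, here
  evaluated in any commutative ring.
\<close>

fun bpoly :: "'r::comm_ring_1 \<Rightarrow> bool list \<Rightarrow> 'r"
  where
    "bpoly x [] = 0"
  | "bpoly x (b # bs) = of_bool b + x * bpoly x bs"

fun padd :: "bool list \<Rightarrow> bool list \<Rightarrow> bool list"
  where
    "padd [] ys = ys"
  | "padd xs [] = xs"
  | "padd (x # xs) (y # ys) = (x \<noteq> y) # padd xs ys"

text \<open>
  Multiplication by the variable \<open>X\<close> modulo \<open>X ^ d + r\<close>, where
  \<open>d\<close> is the length of the coefficient list \<open>r\<close>. Lists of another length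
  are not reduced, so that the congruence \<open>bpoly_pshift\<close> holds for all lists.
\<close>

definition pshift :: "bool list \<Rightarrow> bool list \<Rightarrow> bool list"
  where "pshift r xs =
    (if length xs = length r \<and> xs \<noteq> []
     then padd (False # butlast xs) (if last xs then r else []) else False # xs)"

fun pmult :: "bool list \<Rightarrow> bool list \<Rightarrow> bool list \<Rightarrow> bool list"
  where
    "pmult r [] ys = []"
  | "pmult r (x # xs) ys = padd (if x then ys else []) (pshift r (pmult r xs ys))"

definition pzero :: "bool list \<Rightarrow> bool"
  where "pzero xs \<longleftrightarrow> list_all Not xs"

text \<open>
  A constant of its own, so that the simplifier evaluates the argument once before duplicating it.
\<close>

definition psquare :: "bool list \<Rightarrow> bool list \<Rightarrow> bool list"
  where "psquare r xs = pmult r xs xs"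

fun psquare_iter :: "bool list \<Rightarrow> nat \<Rightarrow> bool list"
  where
    "psquare_iter r 0 = [False, True]"
  | "psquare_iter r (Suc k) = psquare r (psquare_iter r k)"

lemma bpoly_padd:
  assumes "(1 + 1 :: 'r::comm_ring_1) = 0"
  shows "bpoly (x :: 'r) (padd xs ys) = bpoly x xs + bpoly x ys"
proof (induction xs ys rule: padd.induct)
  case (3 b bs c cs)
  have "of_bool (b \<noteq> c) = (of_bool b + of_bool c :: 'r)" using assms by (cases b; cases c) auto
  then show ?case using 3 by (simp add: algebra_simps)
qed auto

lemma bpoly_snoc: "bpoly x (xs @ [b]) = bpoly x xs + of_bool b * x ^ length xs"
  by (induction xs) (auto simp: algebra_simps)

lemma bpoly_pshift:
  assumes "(1 + 1 :: 'r::comm_ring_1) = 0"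
  shows "x ^ length r + bpoly x r dvd bpoly (x :: 'r) (pshift r xs) - x * bpoly x xs"
proof (cases "length xs = length r \<and> xs \<noteq> []")
  case True
  then obtain ys b where xs: "xs = ys @ [b]" by (metis append_butlast_last_id)
  have len: "length r = Suc (length ys)" using True by (simp add: xs)
  have char2: "a + a = 0" for a :: 'r using assms by (metis mult.right_neutral mult_zero_right distrib_left)
  have "bpoly x (pshift r xs) - x * bpoly x xs = of_bool b * (bpoly x r - x ^ length r)"
    using True by (simp add: pshift_def xs bpoly_padd [OF assms] bpoly_snoc len algebra_simps)
  also have "\<dots> = of_bool b * (x ^ length r + bpoly x r)"
    using minus_unique [OF char2, of "x ^ length r"] by (simp only: diff_conv_add_uminus add.commute)
  finally show ?thesis by simp
next
  case False
  then show ?thesis by (auto simp: pshift_def)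
qed

lemma bpoly_pmult:
  assumes "(1 + 1 :: 'r::comm_ring_1) = 0"
  shows "x ^ length r + bpoly x r dvd bpoly (x :: 'r) (pmult r xs ys) - bpoly x xs * bpoly x ys"
proof (induction xs)
  case (Cons b xs)
  have "bpoly x (pmult r (b # xs) ys) - bpoly x (b # xs) * bpoly x ys
      = (bpoly x (pshift r (pmult r xs ys)) - x * bpoly x (pmult r xs ys))
        + x * (bpoly x (pmult r xs ys) - bpoly x xs * bpoly x ys)"
    by (simp add: bpoly_padd [OF assms] algebra_simps)
  then show ?case using Cons bpoly_pshift [OF assms, of x r "pmult r xs ys"]
    by (simp only: dvd_add dvd_mult)
qed simp

lemma bpoly_psquare_iter:
  assumes "(1 + 1 :: 'r::comm_ring_1) = 0"
  shows "x ^ length r + bpoly x r dvd bpoly (x :: 'r) (psquare_iter r k) - x ^ (2 ^ k)"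
proof (induction k)
  case (Suc k)
  let ?m = "x ^ length r + bpoly x r" and ?y = "psquare_iter r k"
  have "psquare_iter r (Suc k) = pmult r ?y ?y" by (simp add: psquare_def)
  moreover have "?m dvd bpoly x (pmult r ?y ?y) - bpoly x ?y * bpoly x ?y" by (rule bpoly_pmult [OF assms])
  moreover have "?m dvd (bpoly x ?y - x ^ (2 ^ k)) * (bpoly x ?y + x ^ (2 ^ k))" using Suc by simp
  ultimately have "?m dvd (bpoly x (psquare_iter r (Suc k)) - bpoly x ?y * bpoly x ?y)
      + (bpoly x ?y - x ^ (2 ^ k)) * (bpoly x ?y + x ^ (2 ^ k))" by (simp only: dvd_add)
  also have "\<dots> = bpoly x (psquare_iter r (Suc k)) - x ^ (2 ^ k) * x ^ (2 ^ k)"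
    by (simp add: algebra_simps)
  also have "x ^ (2 ^ k) * x ^ (2 ^ k) = x ^ (2 ^ Suc k)" by (simp flip: power_add mult_2)
  finally show ?case .
qed simp

lemma bpoly_pzero: "pzero xs \<Longrightarrow> bpoly x xs = 0"
  by (induction xs) (auto simp: pzero_def)

text \<open>
  The images of \<open>vs\<close> under the polynomial \<open>X * (X + v)\<close>, which vanishes on
  \<open>{0, v}\<close>.
\<close>

definition preduce :: "bool list \<Rightarrow> bool list \<Rightarrow> bool list list \<Rightarrow> bool list list"
  where "preduce r v vs = map (\<lambda>x. pmult r x (padd x v)) vs"

text \<open>
  Adjoining the generators one at a time, the composition formula for \<open>A = {0, v}\<close>
  needs only the inverse of the current generator \<open>v\<close>; the remaining ones are replaced
  by their images under \<open>X * (X + v)\<close>. The list \<open>ws\<close> supplies the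
  inverses. That they exist also shows that the generators are independent.
\<close>

fun inverse_cert :: "bool list \<Rightarrow> bool list list \<Rightarrow> bool list list \<Rightarrow> bool"
  where
    "inverse_cert r [] ws \<longleftrightarrow> True"
  | "inverse_cert r (v # vs) [] \<longleftrightarrow> False"
  | "inverse_cert r (v # vs) (w # ws) \<longleftrightarrow>
      pzero (padd [True] (pmult r v w)) \<and> inverse_cert r (preduce r v vs) ws"

text \<open>
  The inverse sum of the span, computed by \<open>S(V) = 1 / v + v * S(B)\<close>.
\<close>

fun cert_sum :: "bool list \<Rightarrow> bool list list \<Rightarrow> bool list list \<Rightarrow> bool list"
  where
    "cert_sum r (v # vs) (w # ws) = padd w (pmult r v (cert_sum r (preduce r v vs) ws))"
  | "cert_sum r vs ws = []"

definition bits :: "nat \<Rightarrow> nat list \<Rightarrow> bool list"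
  where "bits d is = map (\<lambda>i. i \<in> set is) [0..<d]"

text \<open>
  The modulus is \<open>X ^ d + r\<close>, the generators are the powers \<open>x ^ e\<close> of a
  root \<open>x\<close>, and polynomials are given by their sets of exponents. The first condition
  says that the modulus divides \<open>X ^ (2 ^ n) - X\<close>.
\<close>

definition cert_ok :: "nat \<Rightarrow> nat \<Rightarrow> nat list \<Rightarrow> nat list \<Rightarrow> nat list list \<Rightarrow> bool"
  where "cert_ok n d r es ws \<longleftrightarrow>
    pzero (padd [False, True] (psquare_iter (bits d r) n)) \<and>
    inverse_cert (bits d r) (map (\<lambda>e. bits d [e]) es) (map (bits d) ws) \<and>
    pzero (cert_sum (bits d r) (map (\<lambda>e. bits d [e]) es) (map (bits d) ws))"

text \<open>
  Dimension 4 for \<open>n = 9\<close>: the span of \<open>1, x\<^sup>3, x^5, x^6\<close> with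
  \<open>x^9 + x^7 + x\<^sup>2 + x + 1 = 0\<close>.
\<close>

lemma cert_9: "cert_ok 9 9 [0, 1, 2, 7] [0, 3, 5, 6]
    [[0], [1, 2, 6], [3, 4, 5, 7], [2, 4, 6, 7, 8]]"
  by code_simp

text \<open>
  Dimension 5 for \<open>n = 13\<close>: the span of \<open>1, x\<^sup>2, x\<^sup>3, x^5,
  x^9\<close> with \<open>x^13 + x^11 + x^7 + x\<^sup>2 + 1 = 0\<close>.
\<close>

lemma cert_13: "cert_ok 13 13 [0, 2, 7, 11] [0, 2, 3, 5, 9]
    [[0], [1, 2, 4, 5, 6, 9, 11, 12], [2, 3, 9, 10, 11], [0, 2, 4, 10, 11], [0, 1, 5, 8, 11]]"
  by code_simp

text \<open>
  Dimension 5 for \<open>n = 15\<close>: the subfield with 32 elements, generated by a root of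
  \<open>X^5 + X\<^sup>2 + 1\<close>.
\<close>

lemma cert_15: "cert_ok 15 5 [0, 2] [0, 1, 2, 3, 4]
    [[0], [1, 2, 3], [0, 3, 4], [0, 1, 3], [0, 3]]"
  by code_simp

context binary_field
begin

section \<open>Subspaces from certificates\<close>

text \<open>
  The polynomial \<open>X ^ (2 ^ n) - X\<close> vanishes on the whole field. If its divisor of
  degree \<open>d > 0\<close> had no root, the cofactor, of degree \<open>2 ^ n - d\<close>, would
  have \<open>2 ^ n\<close> roots.
\<close>

lemma exists_root:
  assumes "r \<noteq> []" "pzero (padd [False, True] (psquare_iter r n))"
  shows "\<exists>x :: 'a. x ^ length r = bpoly x r"
proof (rule ccontr)
  assume contr: "\<nexists>x :: 'a. x ^ length r = bpoly x r"
  define X :: "'a poly" where "X = [:0, 1:]"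
  define P where "P = X ^ length r + bpoly X r"
  define F where "F = X ^ (2 ^ n) - X"
  have char2: "(1 + 1 :: 'a poly) = 0" by (simp add: one_pCons)
  have char2': "a + a = 0" for a :: "'a poly" by (metis char2 distrib_left mult.right_neutral mult_zero_right)
  have "bpoly X [False, True] + bpoly X (psquare_iter r n) = 0"
    using bpoly_pzero [OF assms(2), of X] by (simp only: bpoly_padd [OF char2])
  then have "bpoly X (psquare_iter r n) = X"
    using char2' [of X] by (simp add: add_eq_0_iff) 
  then have "P dvd X - X ^ (2 ^ n)"
    using bpoly_psquare_iter [OF char2, of X r n] by (simp add: P_def)
  then obtain Q where Q: "F = P * Q"
    unfolding F_def by (metis dvdE dvd_minus_iff minus_diff_eq)
  have "poly (bpoly X xs) x = bpoly x xs" for x xs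
    by (induction xs) (auto simp: X_def)
  then have polyP: "poly P x = x ^ length r + bpoly x r" for x
    by (simp add: P_def X_def)
  have "poly F x = 0" for x by (simp add: F_def X_def power_field_size)
  then have "poly Q x = 0" for x
    using Q polyP [of x] contr by (metis add_eq_0 mult_eq_0_iff poly_mult)
  then have roots: "{x. poly Q x = 0} = UNIV" by auto
  have deg_less: "degree (bpoly X xs) < k" if "length xs \<le> k" "k > 0" for xs k
    using that
  proof (induction xs arbitrary: k)
    case (Cons b xs)
    have "degree (X * bpoly X xs) < k"
    proof (cases "xs = []")
      case False
      then have "degree (bpoly X xs) < k - 1" using Cons by (cases xs) auto
      then show ?thesis using Cons.prems by (auto simp: X_def)
    qed (use Cons in simp)
    then show ?case using Cons.prems by (auto intro!: degree_add_less)
  qed simp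
  have "degree (X ^ k) = k" for k by (simp add: X_def degree_power_eq)
  moreover from this have "degree P = length r" unfolding P_def
    using deg_less [of r "length r"] assms(1) by (subst degree_add_eq_left) auto
  moreover have "degree F = 2 ^ n"
  proof -
    have "degree X < degree (X ^ (2 ^ n))" using calculation(1) one_less_power [of "2 :: nat" n] n_pos by (simp add: X_def)
    then show ?thesis unfolding F_def using calculation(1)
      by (metis degree_add_eq_left degree_minus diff_conv_add_uminus)
  qed
  moreover have "Q \<noteq> 0" using Q calculation(3) by auto
  ultimately have "degree Q + length r = 2 ^ n"
    using Q assms(1) by (metis add.commute degree_0 degree_mult_eq length_0_conv)
  moreover have "2 ^ n \<le> degree Q" using card_poly_roots_bound [OF \<open>Q \<noteq> 0\<close>] roots by (simp add: card_field)
  moreover have "length r > 0" using assms(1) by simp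
  ultimately show False by linarith
qed

text \<open>
  The composition formula for \<open>A = {0, v}\<close>, where \<open>L(x) = x * (x + v)\<close>.
  The bound by the span is what makes the resulting subspace again usable as \<open>B\<close> in the
  next step.
\<close>

lemma adjoin_generator:
  assumes v: "v \<noteq> 0" and B: "F2.subspace B" "B \<subseteq> F2.span ((\<lambda>x. x * (x + v)) ` S)"
  obtains V where "F2.subspace V" "V \<subseteq> F2.span (insert v S)"
    "F2.dim V = Suc (F2.dim B)" "inv_sum V = inverse v + v * inv_sum B"
proof
  let ?A = "{0, v}" and ?V = "vanish {0, v} -` B"
  have A: "F2.subspace ?A" by (auto simp: subspace_iff)
  have L: "vanish ?A = (\<lambda>x. x * (x + v))" using v by (auto simp: vanish_def fun_eq_iff)
  have "F2.span (vanish ?A ` S) \<subseteq> vanish ?A ` F2.span S"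
    using subspace_image_vanish [OF A F2.subspace_span]
    by (intro F2.span_minimal image_mono F2.span_superset)
  with B have sub: "B \<subseteq> vanish ?A ` F2.span S" by (simp add: L)
  then have range: "B \<subseteq> range (vanish ?A)" by auto
  show "F2.subspace ?V" by (rule subspace_vimage_vanish [OF A B(1)])
  have "F2.dim ?A = 1" using A by (rule dim_eqI) (use v in simp)
  then show "F2.dim ?V = Suc (F2.dim B)" using compose_subspaces(1) [OF A B(1) range] by simp
  have "?A - {0} = {v}" using v by auto
  then show "inv_sum ?V = inverse v + v * inv_sum B"
    using compose_subspaces(2) [OF A B(1) range] v by (simp add: inv_sum_def slope_def)
  show "?V \<subseteq> F2.span (insert v S)"
  proof
    fix x assume "x \<in> ?V"
    then obtain y where y: "y \<in> F2.span S" "vanish ?A x = vanish ?A y" using sub by auto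
    then have "x \<in> (+) y ` ?A" using vanish_fibre [OF A, of y] by blast
    then show "x \<in> F2.span (insert v S)" using y(1) by (auto simp: span_insert_eq image_iff add.commute)
  qed
qed

lemma inverse_cert_sound:
  assumes "x ^ length r = bpoly (x :: 'a) r" "inverse_cert r vs ws"
  shows "\<exists>V. F2.subspace V \<and> V \<subseteq> F2.span (bpoly x ` set vs) \<and> F2.dim V = length vs \<and>
    inv_sum V = bpoly x (cert_sum r vs ws)"
  using assms
proof (induction r vs ws rule: inverse_cert.induct)
  case (1 r ws)
  have "F2.subspace {0}" "inv_sum {0} = 0" by (simp_all add: inv_sum_def)
  moreover from this have "F2.dim {0} = 0" by (intro dim_eqI) auto
  ultimately show ?case by (intro exI [of _ "{0}"]) auto
next
  case (3 r v vs w ws)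
  let ?v = "bpoly x v" and ?vs' = "preduce r v vs"
  have char2: "(1 + 1 :: 'a) = 0" by simp
  have mult: "bpoly x (pmult r ys zs) = bpoly x ys * bpoly x zs" for ys zs
    using bpoly_pmult [OF char2, of x r ys zs] 3(2) by simp
  have one: "pzero (padd [True] (pmult r v w))" and cert: "inverse_cert r ?vs' ws"
    using 3(3) by auto
  have "1 + ?v * bpoly x w = 0"
    using bpoly_pzero [OF one, of x] by (simp add: bpoly_padd [OF char2] mult)
  then have "?v * bpoly x w = 1" by simp
  then have v: "?v \<noteq> 0" "bpoly x w = inverse ?v" by (auto simp: inverse_unique)
  have set: "bpoly x ` set ?vs' = (\<lambda>y. y * (y + ?v)) ` bpoly x ` set vs"
    by (simp add: preduce_def image_image mult bpoly_padd [OF char2])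
  obtain B where B: "F2.subspace B" "B \<subseteq> F2.span ((\<lambda>y. y * (y + ?v)) ` bpoly x ` set vs)"
    "F2.dim B = length vs" "inv_sum B = bpoly x (cert_sum r ?vs' ws)"
    using 3(1) [OF 3(2) cert] unfolding set by (auto simp: preduce_def)
  obtain V where "F2.subspace V" "V \<subseteq> F2.span (insert ?v (bpoly x ` set vs))"
    "F2.dim V = Suc (F2.dim B)" "inv_sum V = inverse ?v + ?v * inv_sum B"
    using adjoin_generator [OF v(1) B(1,2)] .
  then show ?case using B(3,4) by (auto simp: bpoly_padd [OF char2] mult v)
qed auto

lemma zero_sum_dim_from_cert:
  assumes "r \<noteq> []" "pzero (padd [False, True] (psquare_iter r n))"
    and "inverse_cert r vs ws" "pzero (cert_sum r vs ws)"
  shows "zero_sum_dim (length vs)"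
proof -
  obtain x :: 'a where "x ^ length r = bpoly x r" using exists_root [OF assms(1,2)] by blast
  from inverse_cert_sound [OF this assms(3)] show ?thesis
    using bpoly_pzero [OF assms(4), of x] unfolding zero_sum_dim_def by metis
qed

lemma zero_sum_dim_from_cert_ok:
  assumes "cert_ok n d r es ws" "d > 0" "length es = k"
  shows "zero_sum_dim k"
proof -
  have "bits d r \<noteq> []" using assms(2) by (simp add: bits_def)
  then show ?thesis
    using zero_sum_dim_from_cert [of "bits d r" "map (\<lambda>e. bits d [e]) es" "map (bits d) ws"] assms
    by (simp add: cert_ok_def)
qed

section \<open>Dimensions two to five and the general case\<close>

text \<open>
  Averaging over the extensions of \<open>{0, 1}\<close>; with \<open>q = 2 ^ n\<close> the
  condition is \<open>16 * sqrt 6 * q * sqrt q < (q - 4) * (q - 49)\<close>.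
\<close>

lemma zero_sum_dim_4_odd:
  assumes "odd n" "n \<ge> 11"
  shows "zero_sum_dim 4"
proof -
  define t where "t = sqrt (2 ^ n :: real)"
  have t2: "2 ^ n = t\<^sup>2" by (simp add: t_def)
  \<comment> \<open>The proof needs \<open>t > 40\<close> with some room, and \<open>45\<^sup>2 \<le> 2 ^ 11\<close>.\<close>
  have "(2::real) ^ 11 \<le> 2 ^ n" using assms by (intro power_increasing) auto
  then have "sqrt (45\<^sup>2) \<le> t" unfolding t_def by (intro real_sqrt_le_mono) simp
  then have t: "t \<ge> 45" by simp
  have "sqrt 6 \<le> 5 / 2" by (rule real_le_lsqrt) (auto simp: power2_eq_square)
  then have "16 * (sqrt 6 * t\<^sup>2 * t) \<le> 16 * (5 / 2 * t\<^sup>2 * t)"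
    using t by (intro mult_left_mono mult_right_mono) auto
  also have "\<dots> = t\<^sup>2 * (40 * t)" by simp
  also have "\<dots> < t\<^sup>2 * (t\<^sup>2 - 53)"
  proof -
    have "45 * 5 \<le> t * (t - 40)" using t by (intro mult_mono) auto
    then have "40 * t < t\<^sup>2 - 53" by (simp add: power2_eq_square algebra_simps)
    then show ?thesis using t by simp
  qed
  also have "\<dots> \<le> (t\<^sup>2 - 4) * (t\<^sup>2 - 49)" by (simp add: algebra_simps)
  finally have bound: "16 * (sqrt 6 * t\<^sup>2 * t) < (t\<^sup>2 - 4) * (t\<^sup>2 - 49)" .
  have "45 * 45 \<le> t * t" using t by (intro mult_mono) auto
  then have pos: "49 \<le> t\<^sup>2" by (simp add: power2_eq_square)
  have "zero_sum_dim (3 + F2.dim {0, 1})"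
  proof (rule zero_sum_dim_by_averaging [OF assms(1) subspace_F2])
    have card: "card {0, 1 :: 'a} = 2" by simp
    show "0 \<le> 2 ^ n - 1 - 3 * (2 * real (card {0, 1 :: 'a}))\<^sup>2"
      unfolding card t2 using pos by simp
    show "(2 * real (card {0, 1 :: 'a}))\<^sup>2 * (sqrt (2 * card {0, 1 :: 'a} + 2) * 2 ^ n * sqrt (2 ^ n))
      < (2 ^ n - 2 * real (card {0, 1 :: 'a})) * (2 ^ n - 1 - 3 * (2 * real (card {0, 1 :: 'a}))\<^sup>2)"
      unfolding card t_def [symmetric] unfolding t2 using bound by simp
  qed (simp_all add: dim_F2 inv_sum_F2)
  then show ?thesis by (simp add: dim_F2)
qed

text \<open>
  Averaging over the extensions of a plane; the condition is \<open>64 * sqrt 10 * q * sqrt q < (q -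
  8) * (q - 193)\<close>.
\<close>

lemma zero_sum_dim_5_odd:
  assumes "odd n" "n \<ge> 17"
  shows "zero_sum_dim 5"
proof -
  have "\<not> UNIV \<subseteq> {0, 1 :: 'a}"
  proof
    assume "UNIV \<subseteq> {0, 1 :: 'a}"
    then have "card (UNIV :: 'a set) \<le> 2" using card_mono [of "{0, 1 :: 'a}" UNIV] by simp
    moreover have "(2::nat) ^ 2 \<le> 2 ^ n" using assms by (intro power_increasing) auto
    ultimately show False by (simp add: card_field)
  qed
  then obtain w :: 'a where w: "1 \<noteq> (0::'a)" "w \<noteq> 0" "1 \<noteq> w" by auto
  define t where "t = sqrt (2 ^ n :: real)"
  have t2: "2 ^ n = t\<^sup>2" by (simp add: t_def)
  \<comment> \<open>The proof needs \<open>t > 1024 / 5\<close> with some room, and \<open>256\<^sup>2 \<le> 2 ^ 17\<close>.\<close>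
  have "(2::real) ^ 17 \<le> 2 ^ n" using assms by (intro power_increasing) auto
  then have "sqrt (256\<^sup>2) \<le> t" unfolding t_def by (intro real_sqrt_le_mono) simp
  then have t: "t \<ge> 256" by simp
  have "sqrt 10 \<le> 16 / 5" by (rule real_le_lsqrt) (auto simp: power2_eq_square)
  then have "64 * (sqrt 10 * t\<^sup>2 * t) \<le> 64 * (16 / 5 * t\<^sup>2 * t)"
    using t by (intro mult_left_mono mult_right_mono) auto
  also have "\<dots> = t\<^sup>2 * (1024 / 5 * t)" by simp
  also have "\<dots> < t\<^sup>2 * (t\<^sup>2 - 201)"
  proof -
    have "256 * (256 - 1024 / 5) \<le> t * (t - 1024 / 5)" using t by (intro mult_mono) auto
    then have "1024 / 5 * t < t\<^sup>2 - 201" by (simp add: power2_eq_square algebra_simps)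
    then show ?thesis using t by simp
  qed
  also have "\<dots> \<le> (t\<^sup>2 - 8) * (t\<^sup>2 - 193)" by (simp add: algebra_simps)
  finally have bound: "64 * (sqrt 10 * t\<^sup>2 * t) < (t\<^sup>2 - 8) * (t\<^sup>2 - 193)" .
  have "256 * 256 \<le> t * t" using t by (intro mult_mono) auto
  then have pos: "193 \<le> t\<^sup>2" by (simp add: power2_eq_square)
  have dim: "F2.dim (plane 1 w) = 2" by (rule dim_plane [OF w])
  have "zero_sum_dim (3 + F2.dim (plane 1 w))"
  proof (rule zero_sum_dim_by_averaging [OF assms(1) subspace_plane])
    have card: "card (plane 1 w) = 4" using card_subspace [OF subspace_plane] dim by simp
    show "F2.dim (plane 1 w) \<ge> 1" by (simp only: dim)
    show "inv_sum (plane 1 w) \<noteq> 0"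
      using qf_anisotropic [OF assms(1), of 1 w] w by (auto simp: inv_sum_plane [OF w])
    show "0 \<le> 2 ^ n - 1 - 3 * (2 * real (card (plane 1 w)))\<^sup>2"
      unfolding card t2 using pos by simp
    show "(2 * real (card (plane 1 w)))\<^sup>2 * (sqrt (2 * card (plane 1 w) + 2) * 2 ^ n * sqrt (2 ^ n))
      < (2 ^ n - 2 * real (card (plane 1 w))) * (2 ^ n - 1 - 3 * (2 * real (card (plane 1 w)))\<^sup>2)"
      unfolding card t_def [symmetric] unfolding t2 using bound by simp
  qed
  then show ?thesis by (simp add: dim)
qed

text \<open>
  The plane is the subfield with four elements.
\<close>

lemma zero_sum_dim_2_even:
  assumes "even n"
  shows "zero_sum_dim 2"
proof -
  have "tr 1 = 0" using assms by (simp add: tr_one of_nat_parity)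
  then obtain w :: 'a where "w\<^sup>2 + w = 1" by (auto simp: tr_eq_0_iff)
  then have w: "1 \<noteq> (0::'a)" "w \<noteq> 0" "1 \<noteq> w" and "qf 1 w = 0"
    by (auto simp: qf_def add_ac)
  then show ?thesis unfolding zero_sum_dim_def
    using subspace_plane [of 1 w] dim_plane [OF w] inv_sum_plane [OF w]
    by (intro exI [of _ "plane 1 w"]) simp
qed

lemma zero_sum_dim_4:
  assumes "n \<ge> 8"
  shows "zero_sum_dim 4"
proof (cases "even n")
  case True
  then show ?thesis using zero_sum_dim_add [OF zero_sum_dim_2_even zero_sum_dim_2_even] assms by simp
next
  case False
  then have "n = 9 \<or> n \<ge> 11" using assms by presburger
  then show ?thesis
  proof
    assume n: "n = 9"
    show ?thesis by (rule zero_sum_dim_from_cert_ok [OF cert_9 [folded n]]) (simp_all add: n_pos)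
  qed (rule zero_sum_dim_4_odd [OF False])
qed

text \<open>
  For \<open>n = 9\<close> the dual dimension is 4, and for \<open>n = 11\<close> it is \<open>6 = 3
  + 3\<close>.
\<close>

lemma zero_sum_dim_5:
  assumes "n \<ge> 8"
  shows "zero_sum_dim 5"
proof (cases "even n")
  case True
  then show ?thesis using zero_sum_dim_add [OF zero_sum_dim_3 zero_sum_dim_2_even] assms by simp
next
  case False
  then have "n = 9 \<or> n = 11 \<or> n = 13 \<or> n = 15 \<or> n \<ge> 17" using assms by presburger
  then consider "n = 9" | "n = 11" | "n = 13" | "n = 15" | "n \<ge> 17" by blast
  then show ?thesis
  proof cases
    case 1
    then show ?thesis using zero_sum_dim_dual [OF zero_sum_dim_4] assms by simp
  next
    case 2
    then have "zero_sum_dim 6" using zero_sum_dim_add [OF zero_sum_dim_3 zero_sum_dim_3] assms by simp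
    then show ?thesis using zero_sum_dim_dual [of 6] 2 by simp
  next
    case 3
    show ?thesis by (rule zero_sum_dim_from_cert_ok [OF cert_13 [folded 3]]) (simp_all add: n_pos)
  next
    case 4
    show ?thesis by (rule zero_sum_dim_from_cert_ok [OF cert_15 [folded 4]]) simp_all
  next
    case 5
    then show ?thesis using zero_sum_dim_5_odd [OF False] by simp
  qed
qed

text \<open>
  Induction from \<open>k - 3\<close> to \<open>k\<close>: the addition step requires \<open>3 * (k
  - 3) < n\<close>, which is the hypothesis on \<open>k\<close>.
\<close>

lemma zero_sum_dim_up_to_third:
  assumes "n \<ge> 8" "3 \<le> k" "3 * k \<le> n + 8"
  shows "zero_sum_dim k"
  using assms(2,3)
proof (induction k rule: less_induct)
  case (less k)
  show ?case
  proof (cases "k \<le> 5")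
    case True
    then have "k = 3 \<or> k = 4 \<or> k = 5" using less.prems by auto
    then show ?thesis using zero_sum_dim_3 zero_sum_dim_4 zero_sum_dim_5 assms(1) by auto
  next
    case False
    then have "zero_sum_dim (k - 3)" using less by simp
    then have "zero_sum_dim (3 + (k - 3))"
      using less.prems False by (intro zero_sum_dim_add zero_sum_dim_3 assms(1)) auto
    then show ?thesis using False by simp
  qed
qed

end

theorem theorem5p4:
  fixes n k :: nat
  assumes "CARD('a::{field,finite}) = 2 ^ n"
    and "n \<ge> 8"
    and "(3 \<le> int k \<and> int k \<le> \<lceil>real n / 3\<rceil> + 2) \<or>
         (\<lfloor>2 * real n / 3\<rfloor> - 2 \<le> int k \<and> int k \<le> int n - 3)"
  shows "\<not> sum_free k (f_inv :: 'a \<Rightarrow> 'a)"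
proof -
  interpret binary_field n "TYPE('a)" by unfold_locales (rule assms(1))
  have third: "zero_sum_dim m" if "3 \<le> m" "3 * m \<le> n + 8" for m
    using zero_sum_dim_up_to_third assms(2) that by blast
  have "zero_sum_dim k" using assms(3)
  proof
    \<comment> \<open>Over the integers, \<open>k - 3 < n / 3\<close> says \<open>3 * k \<le> n + 8\<close>.\<close>
    assume k: "3 \<le> int k \<and> int k \<le> \<lceil>real n / 3\<rceil> + 2"
    then have "real_of_int (int k - 3) < real n / 3" by linarith
    then have "3 * k \<le> n + 8" by linarith
    then show ?thesis using third k by simp
  next
    \<comment> \<open>Here \<open>n - k\<close> satisfies the bounds of the first case.\<close>
    assume k: "\<lfloor>2 * real n / 3\<rfloor> - 2 \<le> int k \<and> int k \<le> int n - 3"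
    then have "2 * real n / 3 < real_of_int (int k + 3)" by linarith
    then have "3 * (n - k) \<le> n + 8" using k by linarith
    then have "zero_sum_dim (n - k)" using k by (intro third) auto
    moreover have "n \<ge> 2" using assms(2) by simp
    ultimately have "zero_sum_dim (n - (n - k))" by (rule zero_sum_dim_dual)
    moreover have "n - (n - k) = k" using k by linarith
    ultimately show ?thesis by (simp only:)
  qed
  then show ?thesis by (rule zero_sum_dim_imp_not_sum_free)
qed

end
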